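(* Let $a\in(0,1)$, let $p=(p_1,\ldots,p_m)$ be a probability vector with $m\ge 2$ and all $p_i>0$, let $t=(t_1,\ldots,t_m)\in\mathbb{R}^m$ with $t_1=0$, $t_2=1$, and let $\mu=\mu_{a,t}^p$. Given any $\kappa>0$, there is $\sigma=\sigma(a,p,\kappa)>0$ such that the following holds: for any Borel probability measure $\nu$ on $\mathbb{R}$ with $\dim_2(\nu)\le 1-\kappa$, \[ \dim_2(\mu*\nu)>\dim_2(\nu)+\sigma . \] More precisely, one can take $\sigma=2\varepsilon$, where $\varepsilon=\varepsilon(a,p,\kappa)>0$ is such that the number $\delta=\delta(\varepsilon,a,p)$ defined by \[ \delta=\frac{\log\left(\lceil 1+1/a\rceil\right)\tilde{\varepsilon}+h(\tilde{\varepsilon})}{\log(1/a)},\qquad \tilde{\varepsilon}=\frac{\log(a)}{\log\left(1-\eta\left(\tfrac{a}{a+1},p\right)\right)}\,\varepsilon, \] satisfies $\kappa-2\varepsilon=\delta$.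
   Context: $\mu_{a,t}^p$ denotes the homogeneous self-similar measure for the iterated function system $\{ax+t_i\}_{i=1}^m$ with weights $p$, that is, the distribution of the random sum $\sum_{n=1}^\infty X_na^n$, where the $X_n$ are independent and identically distributed with $\mathbb{P}(X_n=t_i)=p_i$. For $c\in(0,1)$, $\eta(c,p)=p_1+p_2-\sqrt{p_1^2+2p_1p_2\cos(\pi c)+p_2^2}$. The entropy function is $h(x)=-x\log x-(1-x)\log(1-x)$ for $x\in(0,1)$ (natural logarithm), and $\lceil\cdot\rceil$ is the ceiling function. For a Borel probability measure $\nu$ on $\mathbb{R}$, the $L^2$ (correlation) dimension is \[ \dim_2(\nu)=\liminf_{n\to\infty}\frac{\log\sum_{Q\in\mathcal{D}_n}\nu(Q)^2}{\log(2^{-n})}, \] where $\mathcal{D}_n$ is the partition of $\mathbb{R}$ into dyadic intervals of length $2^{-n}$. The convolution $\mu*\nu$ is the push-forward of $\mu\times\nu$ under $(x,y)\mapsto x+y$.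
   Formalization: Existence of ε with κ−2ε=δ is claimed only for κ≤1: for large κ no ε with ε̃ in (0,1) solves the equation, since 2ε+δ is bounded; for κ>1 no ν has dim₂(ν)≤1−κ, so the rest is vacuous there. *)

theory Defs
  imports "HOL-Probability.Probability"
begin

text \<open>Vectors $(p_1,\dots,p_m)$ and $(t_1,\dots,t_m)$ are functions on \<^typ>\<open>nat\<close>, of which only the
  values on $\{1,\dots,m\}$ are used.\<close>

text \<open>The law $\sum_i p_i \delta_{t_i}$ of one random digit. As a push-forward from the index set it
  adds up the weights of coinciding $t_i$.\<close>

definition digit_law :: "nat \<Rightarrow> (nat \<Rightarrow> real) \<Rightarrow> (nat \<Rightarrow> real) \<Rightarrow> real measure" where
  "digit_law m p t = distr (point_measure {1..m} (\<lambda>i. ennreal (p i))) borel t"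

text \<open>The law of $\sum_{n\ge 1} X_n a^n$ with i.i.d. digits, realised on the product space; the
  coordinate \<^term>\<open>x n\<close> plays the role of $X_{n+1}$. Lemma \<open>distr_iid_digits\<close> below shows that
  every other i.i.d. realisation gives the same measure.\<close>

definition self_similar_measure ::
    "nat \<Rightarrow> real \<Rightarrow> (nat \<Rightarrow> real) \<Rightarrow> (nat \<Rightarrow> real) \<Rightarrow> real measure" where
  "self_similar_measure m a p t =
     distr (\<Pi>\<^sub>M n\<in>(UNIV :: nat set). digit_law m p t) borel (\<lambda>x. \<Sum>n. x n * a ^ (n + 1))"

definition dyadic_intervals :: "nat \<Rightarrow> real set set" where
  "dyadic_intervals n = range (\<lambda>k :: int. {of_int k / 2 ^ n ..< (of_int k + 1) / 2 ^ n})"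

text \<open>The quotient is formed in the reals: for a probability measure the sum lies in $(0,1]$. Only the
  lower limit is taken in \<^typ>\<open>ereal\<close>. The term for $n = 0$ is a division by zero and
  does not affect it.\<close>

definition dim2 :: "real measure \<Rightarrow> ereal" where
  "dim2 \<nu> = liminf (\<lambda>n. ereal
     (ln (\<Sum>\<^sub>\<infinity>Q\<in>dyadic_intervals n. (measure \<nu> Q)\<^sup>2) / ln (1 / 2 ^ n)))"

definition eta :: "real \<Rightarrow> (nat \<Rightarrow> real) \<Rightarrow> real" where
  "eta c p = p 1 + p 2 - sqrt ((p 1)\<^sup>2 + 2 * p 1 * p 2 * cos (pi * c) + (p 2)\<^sup>2)"

definition entropy_fun :: "real \<Rightarrow> real" where
  "entropy_fun x = - x * ln x - (1 - x) * ln (1 - x)"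

definition eps_tilde :: "real \<Rightarrow> real \<Rightarrow> (nat \<Rightarrow> real) \<Rightarrow> real" where
  "eps_tilde \<epsilon> a p = ln a / ln (1 - eta (a / (a + 1)) p) * \<epsilon>"

definition delta :: "real \<Rightarrow> real \<Rightarrow> (nat \<Rightarrow> real) \<Rightarrow> real" where
  "delta \<epsilon> a p =
     (ln (of_int \<lceil>1 + 1 / a\<rceil>) * eps_tilde \<epsilon> a p + entropy_fun (eps_tilde \<epsilon> a p)) / ln (1 / a)"

text \<open>The entropy function is only defined on $(0,1)$, so $\delta(\varepsilon,a,p)$ is meaningful
  only when $\tilde\varepsilon \in (0,1)$. This requirement has to be explicit, because \<^const>\<open>ln\<close> is
  total.\<close>

definition admissible_eps :: "real \<Rightarrow> (nat \<Rightarrow> real) \<Rightarrow> real \<Rightarrow> real \<Rightarrow> bool" where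
  "admissible_eps a p \<kappa> \<epsilon> \<longleftrightarrow>
     \<epsilon> > 0 \<and> eps_tilde \<epsilon> a p \<in> {0<..<1} \<and> \<kappa> - 2 * \<epsilon> = delta \<epsilon> a p"

lemma (in prob_space) distr_iid_digits:
  assumes "indep_vars (\<lambda>_. borel) X (UNIV :: nat set)"
    and "\<And>n. distr M borel (X n) = digit_law m p t"
  shows "distr M borel (\<lambda>\<omega>. \<Sum>n. X n \<omega> * a ^ (n + 1)) = self_similar_measure m a p t"
proof -
  have rv: "random_variable borel (X n)" for n
    using assms(1) by (simp add: indep_vars_def)
  have eq: "distr M (\<Pi>\<^sub>M n\<in>(UNIV :: nat set). borel) (\<lambda>\<omega>. \<lambda>n\<in>UNIV. X n \<omega>)
      = (\<Pi>\<^sub>M n\<in>(UNIV :: nat set). digit_law m p t)"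
    using assms rv by (subst (asm) indep_vars_iff_distr_eq_PiM) auto
  show ?thesis
    unfolding self_similar_measure_def eq[symmetric]
    by (subst distr_distr) (use rv in \<open>auto simp: comp_def\<close>)
qed

end

theory Submission
  imports Defs "HOL-Real_Asymp.Real_Asymp"
begin

text \<open>Correlation dimension is read off from the Fourier transform. Averaging $|\hat\nu(Tu)|^2$ over $u$
against a triangular density gives, by Fubini, the average of a nonnegative kernel of width $1/T$
over pairs of points drawn from $\nu$. For $T = 2^n$ this energy is comparable to the sum of
$\nu(Q)^2$ over dyadic intervals of length $2^{-n}$ (\<open>dyadic_sum_le_energy\<close>,
\<open>energy_le_dyadic_sum\<close>), so it suffices to bound the energy of $\mu*\nu$, in which
$|\hat\nu|^2$ is multiplied by $|\hat\mu|^2$.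

By self-similarity, $|\hat\mu(2\pi\xi)|$ is at most $\rho^b$ with $\rho = 1-\eta(a/(a+1),p) < 1$, where
$b$ counts the $n \le N$ for which $a^n\xi$ has distance at least $a/(2(1+a))$ from the integers; at
such a scale the digits $t_1 = 0$ and $t_2 = 1$ cannot be in phase. Frequencies with small $b$ are rare.
Indeed $1/(1+a)$ is the length of a gap between the neighbourhoods of two consecutive integers, so an
interval of that length meets only one neighbourhood, whose length is $a/(1+a)$ and
which magnifies by $1/a$ to a single interval of the original length. The part outside costs a factor
$\lambda \le 1$ and magnifies to at most $\lceil 1/a\rceil$ such intervals. Hence the integral of
$\lambda^b$ grows at most by a factor $1+\lambda\lceil 1/a\rceil$ per scale
(\<open>far_count_integral_le\<close>), without any enumeration of the sets of exceptional scales.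

Where $b \ge x'N$, the energy of $\nu$ is multiplied by at most $\rho^{2x'N}$, a power gain. The remaining
frequencies are estimated trivially by $|\hat\nu| \le 1$ and contribute at most a constant times
$(a\lambda^{-x'}(1+\lambda\lceil 1/a\rceil))^N$. For a suitable $\lambda$ the logarithm of
$\lambda^{-x'}(1+\lambda\lceil 1/a\rceil)$ is strictly below
$\tilde\varepsilon\log\lceil 1+1/a\rceil + h(\tilde\varepsilon)$, even for some threshold $x'$ slightly above
$\tilde\varepsilon$, because $\lceil 1/a\rceil < \lceil 1+1/a\rceil$ (\<open>exponent_gap\<close>). With
$\kappa - 2\varepsilon = \delta$ and $\dim_2\nu \le 1-\kappa$ this contribution decays faster than the rate
$\dim_2\nu + 2\varepsilon$, and the raised threshold makes the gain in the first part strictly larger than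
$2\varepsilon$.\<close>

section \<open>Correlation dimension and Fourier energy\<close>

text \<open>The right half of the triangular density on $[-1,1]$, normalised. Since $|\hat\nu|^2$ is even, it has
the same average against this half as against the whole triangle. The triangle is the convolution of an interval with itself, so its cosine
transform is a square and in particular nonnegative.\<close>

definition triangle_law :: "real measure" where
  "triangle_law = density lborel (\<lambda>u. ennreal (2 * (1 - u) * indicator {0..1} u))"

lemma sets_triangle_law [simp, measurable_cong]: "sets triangle_law = sets borel"
  and space_triangle_law [simp]: "space triangle_law = UNIV"
  by (simp_all add: triangle_law_def)

interpretation triangle_law: prob_space triangle_law
proof
  have "emeasure triangle_law (space triangle_law) = (\<integral>\<^sup>+u. ennreal (2 * (1 - u)) * indicator {0..1} u \<partial>lborel)"
    unfolding triangle_law_def by (subst emeasure_density) (auto intro!: nn_integral_cong simp: indicator_def)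
  also have "\<dots> = ennreal ((2 * 1 - 1\<^sup>2) - (2 * 0 - 0\<^sup>2))"
    by (intro nn_integral_FTC_Icc) (auto intro!: derivative_eq_intros)
  finally show "emeasure triangle_law (space triangle_law) = 1"
    by simp
qed

lemma AE_triangle_law: "AE u in triangle_law. 0 \<le> u \<and> u \<le> 1"
  unfolding triangle_law_def by (subst AE_density) (auto simp: indicator_def)

definition fejer :: "real \<Rightarrow> real" where
  "fejer z = (\<integral>u. cos (u * z) \<partial>triangle_law)"

lemma integrable_triangle_law_cos: "integrable triangle_law (\<lambda>u. cos (u * z))"
  by (rule triangle_law.integrable_const_bound[where B=1]) auto

lemma fejer_measurable [measurable]: "fejer \<in> borel_measurable borel"
  unfolding fejer_def by measurable

lemma fejer_le_1: "fejer z \<le> 1"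
  unfolding fejer_def by (rule triangle_law.integral_le_const[OF integrable_triangle_law_cos]) auto

lemma fejer_eq: 
  assumes "z \<noteq> 0"
  shows "fejer z = 2 * (1 - cos z) / z\<^sup>2"
proof -
  define F where "F = (\<lambda>u. 2 * ((1 - u) * sin (u * z) / z - cos (u * z) / z\<^sup>2))"
  have "fejer z = (\<integral>u. (2 * (1 - u) * cos (u * z)) * indicator {0..1} u \<partial>lborel)"
    unfolding fejer_def triangle_law_def
    by (subst integral_density) (auto simp: indicator_def mult_ac intro!: AE_I2 Bochner_Integration.integral_cong)
  also have "\<dots> = F 1 - F 0"
    using assms unfolding F_def
    by (intro integral_FTC_Icc_real)
       (auto intro!: derivative_eq_intros continuous_intros simp: field_simps power2_eq_square)
  also have "\<dots> = 2 * (1 / z\<^sup>2 - cos z / z\<^sup>2)"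
    by (simp add: F_def)
  also have "\<dots> = 2 * (1 - cos z) / z\<^sup>2"
    by (simp only: diff_divide_distrib[symmetric] times_divide_eq_right)
  finally show ?thesis .
qed

lemma fejer_nonneg: "0 \<le> fejer z"
proof (cases "z = 0")
  case True
  then show ?thesis by (simp add: fejer_def)
next
  case False
  then show ?thesis by (simp add: fejer_eq)
qed

lemma fejer_ge_half:
  assumes "\<bar>z\<bar> \<le> 1"
  shows "1 / 2 \<le> fejer z"
proof -
  have "1 / 2 \<le> cos (u * z)" if "0 \<le> u" "u \<le> 1" for u
  proof -
    have "cos (pi / 3) \<le> cos \<bar>u * z\<bar>"
    proof (rule cos_monotone_0_pi_le)
      have "\<bar>u * z\<bar> \<le> 1"
        using that assms by (simp add: abs_mult mult_le_one)
      then show "\<bar>u * z\<bar> \<le> pi / 3"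
        using pi_gt3 by linarith
    qed auto
    then show ?thesis
      by (simp add: cos_60)
  qed
  then show ?thesis
    unfolding fejer_def using AE_triangle_law
    by (intro triangle_law.integral_ge_const integrable_triangle_law_cos) auto
qed

text \<open>This decay makes the kernel summable over unit cells, which is what the comparison of the energy with a
sum over diagonal pairs of cells needs.\<close>

lemma fejer_decay: "z\<^sup>2 * fejer z \<le> 4"
proof (cases "z = 0")
  case False
  have "- (2 * cos z) \<le> 2"
    using cos_ge_minus_one[of z] by linarith
  then show ?thesis
    using False by (simp add: fejer_eq)
qed auto

text \<open>A smoothed form of the mean of $|\hat\nu|^2$ over frequencies in $[-T,T]$.\<close>

definition energy :: "real \<Rightarrow> real measure \<Rightarrow> real" where
  "energy T \<nu> = (\<integral>u. (cmod (char \<nu> (T * u)))\<^sup>2 \<partial>triangle_law)"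

lemma (in real_distribution) cmod_char_sq:
  "(cmod (char M v))\<^sup>2 = (\<integral>z. cos (v * (fst z - snd z)) \<partial>(M \<Otimes>\<^sub>M M))"
proof -
  interpret P: pair_prob_space M M ..
  have [simp]: "integrable M (\<lambda>x. cos (v * x))" "integrable M (\<lambda>x. sin (v * x))"
    by (rule integrable_const_bound[where B=1]; simp)+
  have "(\<integral>z. cos (v * (fst z - snd z)) \<partial>(M \<Otimes>\<^sub>M M)) = (\<integral>x. \<integral>y. cos (v * (x - y)) \<partial>M \<partial>M)"
    by (subst P.integral_fst'[symmetric]) (auto intro!: P.integrable_const_bound[where B=1])
  also have "\<dots> = (\<integral>x. cos (v * x) * (\<integral>y. cos (v * y) \<partial>M) + sin (v * x) * (\<integral>y. sin (v * y) \<partial>M) \<partial>M)"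
    by (simp add: right_diff_distrib cos_diff)
  also have "\<dots> = (\<integral>y. cos (v * y) \<partial>M)\<^sup>2 + (\<integral>y. sin (v * y) \<partial>M)\<^sup>2"
    by (simp add: power2_eq_square)
  also have "(\<integral>y. cos (v * y) \<partial>M) = Re (char M v)"
    unfolding char_def by (subst integral_Re[symmetric]) (auto intro!: integrable_iexp simp: Re_exp)
  also have "(\<integral>y. sin (v * y) \<partial>M) = Im (char M v)"
    unfolding char_def by (subst integral_Im[symmetric]) (auto intro!: integrable_iexp simp: Im_exp)
  finally show ?thesis
    by (simp add: cmod_def)
qed

text \<open>Since $|\hat\nu(v)|^2$ is the mean of $\cos(v(x-y))$ over independent points $x$, $y$ with law $\nu$, Fubini
turns the frequency average into a pair interaction.\<close>

lemma (in real_distribution) energy_eq: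
  "ennreal (energy T M) = (\<integral>\<^sup>+x. \<integral>\<^sup>+y. ennreal (fejer (T * (x - y))) \<partial>M \<partial>M)"
proof -
  interpret P: pair_prob_space M M ..
  interpret Q: pair_prob_space triangle_law "M \<Otimes>\<^sub>M M" ..
  have "energy T M = (\<integral>u. \<integral>z. cos (T * u * (fst z - snd z)) \<partial>(M \<Otimes>\<^sub>M M) \<partial>triangle_law)"
    by (simp add: energy_def cmod_char_sq)
  also have "\<dots> = (\<integral>z. \<integral>u. cos (T * u * (fst z - snd z)) \<partial>triangle_law \<partial>(M \<Otimes>\<^sub>M M))"
    by (rule Q.Fubini_integral[symmetric]) (auto intro!: Q.integrable_const_bound[where B=1] simp: case_prod_beta)
  also have "\<dots> = (\<integral>z. fejer (T * (fst z - snd z)) \<partial>(M \<Otimes>\<^sub>M M))"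
    by (simp add: fejer_def mult_ac)
  finally have "ennreal (energy T M) = (\<integral>\<^sup>+z. ennreal (fejer (T * (fst z - snd z))) \<partial>(M \<Otimes>\<^sub>M M))"
    by (subst nn_integral_eq_integral)
       (auto intro!: P.integrable_const_bound[where B=1] simp: fejer_nonneg fejer_le_1)
  also have "\<dots> = (\<integral>\<^sup>+x. \<integral>\<^sup>+y. ennreal (fejer (T * (x - y))) \<partial>M \<partial>M)"
    by (subst nn_integral_fst[symmetric]) auto
  finally show ?thesis .
qed

definition cell :: "nat \<Rightarrow> int \<Rightarrow> real set" where
  "cell n k = {of_int k / 2 ^ n ..< (of_int k + 1) / 2 ^ n}"

lemma cell_measurable [measurable]: "cell n k \<in> sets borel"
  by (simp add: cell_def)

lemma mem_cell: "x \<in> cell n k \<longleftrightarrow> \<lfloor>2 ^ n * x\<rfloor> = k"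
  by (auto simp: cell_def floor_eq_iff field_simps)

text \<open>Functions of the cell of a point are integrated by summing over cells. All double integrals over $\nu$
become double sums over integers in this way.\<close>

lemma (in real_distribution) nn_integral_floor:
  "(\<integral>\<^sup>+x. h \<lfloor>2 ^ n * x\<rfloor> \<partial>M) = (\<integral>\<^sup>+k. h k * ennreal (measure M (cell n k)) \<partial>count_space UNIV)"
proof -
  have "(\<integral>\<^sup>+x. h \<lfloor>2 ^ n * x\<rfloor> \<partial>M) = (\<integral>\<^sup>+x. \<integral>\<^sup>+k. h k * indicator (cell n k) x \<partial>count_space UNIV \<partial>M)"
  proof (rule nn_integral_cong)
    fix x
    have "(\<integral>\<^sup>+k. h k * indicator (cell n k) x \<partial>count_space UNIV)
        = (\<integral>\<^sup>+k. h \<lfloor>2 ^ n * x\<rfloor> * indicator {\<lfloor>2 ^ n * x\<rfloor>} k \<partial>count_space UNIV)"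
      by (intro nn_integral_cong) (auto simp: indicator_def mem_cell)
    then show "h \<lfloor>2 ^ n * x\<rfloor> = (\<integral>\<^sup>+k. h k * indicator (cell n k) x \<partial>count_space UNIV)"
      by (simp add: nn_integral_cmult)
  qed
  also have "\<dots> = (\<integral>\<^sup>+k. \<integral>\<^sup>+x. h k * indicator (cell n k) x \<partial>M \<partial>count_space UNIV)"
    by (rule nn_integral_count_space_nn_integral) auto
  also have "\<dots> = (\<integral>\<^sup>+k. h k * ennreal (measure M (cell n k)) \<partial>count_space UNIV)"
    by (simp add: nn_integral_cmult emeasure_eq_measure)
  finally show ?thesis .
qed

definition dyadic_sum :: "nat \<Rightarrow> real measure \<Rightarrow> real" where
  "dyadic_sum n \<nu> = (\<Sum>\<^sub>\<infinity>Q\<in>dyadic_intervals n. (measure \<nu> Q)\<^sup>2)"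

lemma (in real_distribution) nn_integral_cell: "(\<integral>\<^sup>+k. ennreal (measure M (cell n k)) \<partial>count_space UNIV) = 1"
  using nn_integral_floor[of "\<lambda>_. 1" n] emeasure_space_1 by simp

lemma (in real_distribution) dyadic_sum_eq:
  "ennreal (dyadic_sum n M) = (\<integral>\<^sup>+k. ennreal ((measure M (cell n k))\<^sup>2) \<partial>count_space UNIV)"
proof -
  have inj: "inj (cell n)"
  proof (rule injI)
    fix j k assume eq: "cell n j = cell n k"
    have "of_int j / 2 ^ n \<in> cell n j"
      by (simp add: mem_cell)
    with eq show "j = k"
      by (simp add: mem_cell)
  qed
  have "(\<integral>\<^sup>+k. ennreal ((measure M (cell n k))\<^sup>2) \<partial>count_space UNIV)
      \<le> (\<integral>\<^sup>+k. ennreal (measure M (cell n k)) \<partial>count_space UNIV)"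
    by (intro nn_integral_mono ennreal_leI) (simp add: power2_eq_square mult_left_le)
  then have "(\<integral>\<^sup>+k. ennreal ((measure M (cell n k))\<^sup>2) \<partial>count_space UNIV) < \<infinity>"
    by (simp add: nn_integral_cell le_less_trans)
  then have int: "integrable (count_space UNIV) (\<lambda>k. (measure M (cell n k))\<^sup>2)"
    by (intro integrableI_nonneg) auto
  have "dyadic_intervals n = range (cell n)"
    by (simp add: dyadic_intervals_def cell_def[abs_def])
  then have "dyadic_sum n M = (\<Sum>\<^sub>\<infinity>k. (measure M (cell n k))\<^sup>2)"
    unfolding dyadic_sum_def using inj by (simp add: infsum_reindex comp_def)
  also have "\<dots> = (\<integral>k. (measure M (cell n k))\<^sup>2 \<partial>count_space UNIV)"
    using infsetsum_infsum[of "\<lambda>k. (measure M (cell n k))\<^sup>2" UNIV] int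
    by (simp add: infsetsum_def abs_summable_on_def)
  finally show ?thesis
    using int by (simp add: nn_integral_eq_integral)
qed

text \<open>The dyadic sum is the probability that two independent points share a cell, and on such pairs
the kernel is at least $1/2$.\<close>

lemma (in real_distribution) dyadic_sum_le_energy: "dyadic_sum n M \<le> 2 * energy (2 ^ n) M"
proof -
  have "ennreal (dyadic_sum n M) = (\<integral>\<^sup>+k. ennreal (measure M (cell n k)) * ennreal (measure M (cell n k)) \<partial>count_space UNIV)"
    by (simp add: dyadic_sum_eq power2_eq_square ennreal_mult)
  also have "\<dots> = (\<integral>\<^sup>+x. ennreal (measure M (cell n \<lfloor>2 ^ n * x\<rfloor>)) \<partial>M)"
    by (rule nn_integral_floor[symmetric])
  also have "\<dots> = (\<integral>\<^sup>+x. \<integral>\<^sup>+y. indicator (cell n \<lfloor>2 ^ n * x\<rfloor>) y \<partial>M \<partial>M)"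
    by (simp add: emeasure_eq_measure)
  also have "\<dots> \<le> (\<integral>\<^sup>+x. \<integral>\<^sup>+y. 2 * ennreal (fejer (2 ^ n * (x - y))) \<partial>M \<partial>M)"
  proof (intro nn_integral_mono)
    fix x y :: real
    show "indicator (cell n \<lfloor>2 ^ n * x\<rfloor>) y \<le> 2 * ennreal (fejer (2 ^ n * (x - y)))"
    proof (cases "\<lfloor>2 ^ n * y\<rfloor> = \<lfloor>2 ^ n * x\<rfloor>")
      case True
      then have "\<bar>2 ^ n * x - 2 ^ n * y\<bar> \<le> 1"
        by linarith
      then have "1 / 2 \<le> fejer (2 ^ n * (x - y))"
        by (intro fejer_ge_half) (simp add: right_diff_distrib)
      then have "ennreal 1 \<le> ennreal (2 * fejer (2 ^ n * (x - y)))"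
        by (intro ennreal_leI) simp
      then show ?thesis
        by (simp add: indicator_def ennreal_mult fejer_nonneg)
    qed (simp add: mem_cell)
  qed
  also have "\<dots> = 2 * ennreal (energy (2 ^ n) M)"
    by (simp add: energy_eq nn_integral_cmult)
  finally have "ennreal (dyadic_sum n M) \<le> ennreal (2 * energy (2 ^ n) M)"
    by (simp add: ennreal_mult energy_def)
  then show ?thesis
    by (simp add: ennreal_le_iff energy_def)
qed

text \<open>A majorant of the kernel that depends only on the difference of the unit cells of the two points. The
constant 32 leaves room for pairs in the same or adjacent cells and for the loss from $|x-y|$ to
$|d|/2$.\<close>

definition fejer_weight :: "int \<Rightarrow> real" where
  "fejer_weight d = 32 / (1 + (of_int d)\<^sup>2)"

lemma fejer_le_weight: "fejer (x - y) \<le> fejer_weight (\<lfloor>x\<rfloor> - \<lfloor>y\<rfloor>)"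
proof -
  define d where "d = \<lfloor>x\<rfloor> - \<lfloor>y\<rfloor>"
  show ?thesis
  proof (cases "\<bar>d\<bar> \<le> 1")
    case True
    then have "d = -1 \<or> d = 0 \<or> d = 1" by linarith
    then have "1 \<le> fejer_weight d"
      by (auto simp: fejer_weight_def)
    then show ?thesis
      using fejer_le_1[of "x - y"] by (simp add: d_def)
  next
    case False
    have "\<bar>x - y\<bar> \<ge> \<bar>of_int d\<bar> - 1"
      unfolding d_def by linarith
    moreover have "\<bar>of_int d :: real\<bar> \<ge> 2"
      using False by linarith
    ultimately have "\<bar>of_int d / 2 :: real\<bar> \<le> \<bar>x - y\<bar>"
      by linarith
    then have "(of_int d / 2)\<^sup>2 \<le> (x - y)\<^sup>2"
      by (rule abs_le_square_iff[THEN iffD1])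
    then have "(of_int d / 2)\<^sup>2 * fejer (x - y) \<le> 4"
      using fejer_decay[of "x - y"] mult_right_mono[OF _ fejer_nonneg] by (meson order_trans)
    moreover have "4 \<le> (of_int d :: real)\<^sup>2"
      using power_mono[OF \<open>2 \<le> \<bar>of_int d :: real\<bar>\<close>, of 2] by simp
    ultimately have "fejer (x - y) * (1 + (of_int d)\<^sup>2) \<le> 32"
      using mult_right_mono[OF \<open>4 \<le> _\<close> fejer_nonneg[of "x - y"]] fejer_nonneg[of "x - y"]
      by (simp add: power_divide algebra_simps)
    then show ?thesis
      unfolding fejer_weight_def d_def[symmetric] by (simp add: pos_le_divide_eq add_pos_nonneg)
  qed
qed

lemma fejer_weight_summable: "(\<integral>\<^sup>+d. ennreal (fejer_weight d) \<partial>count_space UNIV) < \<infinity>"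
proof -
  have le: "fejer_weight (int_decode i) \<le> 256 / (real (Suc i))\<^sup>2" for i
  proof -
    let ?d = "of_int (int_decode i) :: real"
    \<comment> \<open>The bijection from the naturals to the integers lists $0,-1,1,-2,2,\dots$, so its $i$-th value
has modulus about $i/2$.\<close>
    have "real (Suc i) \<le> 2 * (1 + \<bar>?d\<bar>)"
      by (auto simp: int_decode_def sum_decode_def elim!: evenE oddE)
    then have "(real (Suc i))\<^sup>2 \<le> (2 * (1 + \<bar>?d\<bar>))\<^sup>2"
      by (intro power_mono) auto
    also have "\<dots> \<le> 8 * (1 + ?d\<^sup>2)"
      using zero_le_power2[of "1 - \<bar>?d\<bar>"] by (simp add: power2_eq_square algebra_simps)
    finally have "32 * (real (Suc i))\<^sup>2 \<le> 256 * (1 + ?d\<^sup>2)"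
      by simp
    moreover have "32 / A \<le> 256 / B" if "32 * B \<le> 256 * A" "0 < A" "0 < B" for A B :: real
      using that by (simp add: field_simps)
    ultimately show ?thesis
      unfolding fejer_weight_def by (simp add: add_pos_nonneg)
  qed
  have "(\<integral>\<^sup>+d. ennreal (fejer_weight d) \<partial>count_space UNIV) = (\<integral>\<^sup>+i. ennreal (fejer_weight (int_decode i)) \<partial>count_space UNIV)"
    by (rule nn_integral_bij_count_space[OF bij_int_decode, symmetric])
  also have "\<dots> \<le> (\<Sum>i. ennreal (256 / (real (Suc i))\<^sup>2))"
    unfolding nn_integral_count_space_nat by (rule suminf_le[OF ennreal_leI[OF le] summableI summableI])
  also have "\<dots> < \<infinity>"
  proof -
    have "summable (\<lambda>i. inverse ((real (Suc i))\<^sup>2))"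
      using summable_ignore_initial_segment[OF inverse_power_summable[of 2, where 'a=real], of 1]
      by simp
    then have "summable (\<lambda>i. 256 / (real (Suc i))\<^sup>2)"
      unfolding divide_inverse by (rule summable_mult)
    then have "(\<Sum>i. ennreal (256 / (real (Suc i))\<^sup>2)) \<noteq> top"
      by (intro ennreal_suminf_neq_top) auto
    then show ?thesis
      unfolding infinity_ennreal_def by (rule top.not_eq_extremum[THEN iffD1])
  qed
  finally show ?thesis .
qed

text \<open>In the double sum $\sum_{j,k} w(j-k) q_j q_k$ over cell masses one estimates $q_j q_k \le q_j^2 + q_k^2$;
each half then factors into the total weight times the dyadic sum.\<close>

lemma energy_le_dyadic_sum: "\<exists>C>0. \<forall>\<nu> n. real_distribution \<nu> \<longrightarrow> energy (2 ^ n) \<nu> \<le> C * dyadic_sum n \<nu>"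
proof -
  obtain W where W: "0 \<le> W" "(\<integral>\<^sup>+d. ennreal (fejer_weight d) \<partial>count_space UNIV) = ennreal W"
    using fejer_weight_summable by (cases "(\<integral>\<^sup>+d. ennreal (fejer_weight d) \<partial>count_space UNIV)") auto
  have bij: "bij (\<lambda>k. j - k)" "bij (\<lambda>k. k - j)" for j :: int
    by (rule bij_betwI[where g="\<lambda>k. j - k"]; simp) (rule bij_betwI[where g="\<lambda>k. k + j"]; simp)
  have W1: "(\<integral>\<^sup>+k. ennreal (fejer_weight (j - k)) \<partial>count_space UNIV) = ennreal W" for j
    using nn_integral_bij_count_space[OF bij(1)[of j], of "\<lambda>d. ennreal (fejer_weight d)"] W by simp
  have W2: "(\<integral>\<^sup>+j. ennreal (fejer_weight (j - k)) \<partial>count_space UNIV) = ennreal W" for k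
    using nn_integral_bij_count_space[OF bij(2)[of k], of "\<lambda>d. ennreal (fejer_weight d)"] W by simp
  have "energy (2 ^ n) \<nu> \<le> (2 * W + 1) * dyadic_sum n \<nu>" if "real_distribution \<nu>" for n \<nu>
  proof -
    interpret real_distribution \<nu> by fact
    define q where "q k = measure \<nu> (cell n k)" for k
    have q0: "0 \<le> q k" for k
      by (simp add: q_def)
    have w0: "0 \<le> fejer_weight d" for d
      by (simp add: fejer_weight_def)
    have D: "ennreal (dyadic_sum n \<nu>) = (\<integral>\<^sup>+k. ennreal ((q k)\<^sup>2) \<partial>count_space UNIV)"
      by (simp add: dyadic_sum_eq q_def)
    have D0: "0 \<le> dyadic_sum n \<nu>"
      by (simp add: dyadic_sum_def infsum_nonneg)
    have "ennreal (energy (2 ^ n) \<nu>) = (\<integral>\<^sup>+x. \<integral>\<^sup>+y. ennreal (fejer (2 ^ n * x - 2 ^ n * y)) \<partial>\<nu> \<partial>\<nu>)"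
      by (simp add: energy_eq right_diff_distrib)
    also have "\<dots> \<le> (\<integral>\<^sup>+x. \<integral>\<^sup>+y. ennreal (fejer_weight (\<lfloor>2 ^ n * x\<rfloor> - \<lfloor>2 ^ n * y\<rfloor>)) \<partial>\<nu> \<partial>\<nu>)"
      by (intro nn_integral_mono ennreal_leI fejer_le_weight)
    also have "\<dots> = (\<integral>\<^sup>+j. \<integral>\<^sup>+k. ennreal (fejer_weight (j - k)) * ennreal (q k) * ennreal (q j) \<partial>count_space UNIV \<partial>count_space UNIV)"
    proof -
      have inner: "(\<integral>\<^sup>+y. ennreal (fejer_weight (j - \<lfloor>2 ^ n * y\<rfloor>)) \<partial>\<nu>)
          = (\<integral>\<^sup>+k. ennreal (fejer_weight (j - k)) * ennreal (q k) \<partial>count_space UNIV)" for j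
        unfolding q_def by (rule nn_integral_floor)
      have outer: "(\<integral>\<^sup>+x. F \<lfloor>2 ^ n * x\<rfloor> \<partial>\<nu>) = (\<integral>\<^sup>+j. F j * ennreal (q j) \<partial>count_space UNIV)" for F
        unfolding q_def by (rule nn_integral_floor)
      show ?thesis
        unfolding inner outer[of "\<lambda>j. \<integral>\<^sup>+k. ennreal (fejer_weight (j - k)) * ennreal (q k) \<partial>count_space UNIV"]
        by (simp only: nn_integral_multc borel_measurable_count_space)
    qed
    also have "\<dots> \<le> (\<integral>\<^sup>+j. \<integral>\<^sup>+k. ennreal (fejer_weight (j - k)) * ennreal ((q k)\<^sup>2)
          + ennreal (fejer_weight (j - k)) * ennreal ((q j)\<^sup>2) \<partial>count_space UNIV \<partial>count_space UNIV)"
    proof (intro nn_integral_mono)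
      fix j k
      have "q k * q j \<le> (q k)\<^sup>2 + (q j)\<^sup>2"
        using sum_squares_bound[of "q k" "q j"] mult_nonneg_nonneg[of "q k" "q j"] q0[of k] q0[of j] by linarith
      then have "ennreal (fejer_weight (j - k) * (q k * q j)) \<le> ennreal (fejer_weight (j - k) * ((q k)\<^sup>2 + (q j)\<^sup>2))"
        by (intro ennreal_leI mult_left_mono w0)
      then show "ennreal (fejer_weight (j - k)) * ennreal (q k) * ennreal (q j)
          \<le> ennreal (fejer_weight (j - k)) * ennreal ((q k)\<^sup>2) + ennreal (fejer_weight (j - k)) * ennreal ((q j)\<^sup>2)"
        by (simp add: ennreal_mult w0 q_def mult_ac distrib_left)
    qed
    also have "\<dots> = (\<integral>\<^sup>+j. \<integral>\<^sup>+k. ennreal (fejer_weight (j - k)) * ennreal ((q k)\<^sup>2) \<partial>count_space UNIV \<partial>count_space UNIV)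
          + (\<integral>\<^sup>+j. \<integral>\<^sup>+k. ennreal (fejer_weight (j - k)) * ennreal ((q j)\<^sup>2) \<partial>count_space UNIV \<partial>count_space UNIV)"
      by (simp add: nn_integral_add)
    also have "(\<integral>\<^sup>+j. \<integral>\<^sup>+k. ennreal (fejer_weight (j - k)) * ennreal ((q k)\<^sup>2) \<partial>count_space UNIV \<partial>count_space UNIV)
          = (\<integral>\<^sup>+k. \<integral>\<^sup>+j. ennreal (fejer_weight (j - k)) * ennreal ((q k)\<^sup>2) \<partial>count_space UNIV \<partial>count_space UNIV)"
      by (rule nn_integral_count_space_nn_integral) auto
    also have "\<dots> = ennreal W * ennreal (dyadic_sum n \<nu>)"
      by (simp add: nn_integral_multc nn_integral_cmult W2 D)
    also have "(\<integral>\<^sup>+j. \<integral>\<^sup>+k. ennreal (fejer_weight (j - k)) * ennreal ((q j)\<^sup>2) \<partial>count_space UNIV \<partial>count_space UNIV)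
          = ennreal W * ennreal (dyadic_sum n \<nu>)"
      by (simp add: nn_integral_multc nn_integral_cmult W1 D)
    finally have "ennreal (energy (2 ^ n) \<nu>) \<le> ennreal (2 * W * dyadic_sum n \<nu>)"
      using W(1) D0 by (simp add: ennreal_mult[symmetric] ennreal_plus[symmetric] del: ennreal_plus)
    then have "energy (2 ^ n) \<nu> \<le> 2 * W * dyadic_sum n \<nu>"
      using W(1) D0 by (simp add: ennreal_le_iff)
    also have "\<dots> \<le> (2 * W + 1) * dyadic_sum n \<nu>"
      using D0 by (intro mult_right_mono) auto
    finally show ?thesis .
  qed
  then show ?thesis
    using W(1) by (intro exI[of _ "2 * W + 1"]) auto
qed

lemma (in real_distribution) dyadic_sum_pos: "0 < dyadic_sum n M"
  and dyadic_sum_le_1: "dyadic_sum n M \<le> 1"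
proof -
  have "dyadic_sum n M \<noteq> 0"
  proof
    assume "dyadic_sum n M = 0"
    then have "(\<integral>\<^sup>+k. ennreal ((measure M (cell n k))\<^sup>2) \<partial>count_space UNIV) = 0"
      by (simp flip: dyadic_sum_eq)
    then have "measure M (cell n k) = 0" for k
      by (simp add: nn_integral_0_iff_AE AE_count_space)
    then show False
      using nn_integral_cell[of n] by simp
  qed
  moreover have "0 \<le> dyadic_sum n M"
    by (simp add: dyadic_sum_def infsum_nonneg)
  ultimately show "0 < dyadic_sum n M" by simp
  have "ennreal (dyadic_sum n M) \<le> (\<integral>\<^sup>+k. ennreal (measure M (cell n k)) \<partial>count_space UNIV)"
    unfolding dyadic_sum_eq by (intro nn_integral_mono ennreal_leI) (simp add: power2_eq_square mult_left_le)
  then show "dyadic_sum n M \<le> 1"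
    by (simp add: nn_integral_cell)
qed

lemma dim2_eq: "dim2 \<nu> = liminf (\<lambda>n. ereal (ln (dyadic_sum n \<nu>) / ln (1 / 2 ^ n)))"
  by (simp add: dim2_def dyadic_sum_def)

lemma (in real_distribution) local_dim_iff:
  assumes "0 < n"
  shows "r < ln (dyadic_sum n M) / ln (1 / 2 ^ n) \<longleftrightarrow> dyadic_sum n M < 2 powr (- r * real n)"
    and "r \<le> ln (dyadic_sum n M) / ln (1 / 2 ^ n) \<longleftrightarrow> dyadic_sum n M \<le> 2 powr (- r * real n)"
proof -
  have eq: "ln (1 / 2 ^ n) = - (real n * ln 2)"
    by (simp add: ln_div ln_realpow)
  have pos: "0 < real n * ln 2"
    using assms by simp
  have D: "dyadic_sum n M = exp (ln (dyadic_sum n M))"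
    using dyadic_sum_pos by simp
  have "dyadic_sum n M < 2 powr (- r * real n) \<longleftrightarrow> ln (dyadic_sum n M) < - r * real n * ln 2"
    by (subst D) (simp add: powr_def)
  then show "r < ln (dyadic_sum n M) / ln (1 / 2 ^ n) \<longleftrightarrow> dyadic_sum n M < 2 powr (- r * real n)"
    unfolding eq using pos by (auto simp: field_simps)
  have "dyadic_sum n M \<le> 2 powr (- r * real n) \<longleftrightarrow> ln (dyadic_sum n M) \<le> - r * real n * ln 2"
    by (subst D) (simp add: powr_def)
  then show "r \<le> ln (dyadic_sum n M) / ln (1 / 2 ^ n) \<longleftrightarrow> dyadic_sum n M \<le> 2 powr (- r * real n)"
    unfolding eq using pos by (auto simp: field_simps)
qed

lemma (in real_distribution) dim2_gtD:
  assumes "ereal r < dim2 M"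
  shows "\<forall>\<^sub>F n in sequentially. dyadic_sum n M < 2 powr (- r * real n)"
proof -
  have "\<forall>\<^sub>F n in sequentially. ereal r < ereal (ln (dyadic_sum n M) / ln (1 / 2 ^ n))"
    using assms unfolding dim2_eq by (rule less_LiminfD)
  then show ?thesis
    using eventually_gt_at_top[of 0] by eventually_elim (simp add: local_dim_iff)
qed

lemma (in real_distribution) dim2_geI:
  assumes "\<forall>\<^sub>F n in sequentially. dyadic_sum n M \<le> 2 powr (- r * real n)"
  shows "ereal r \<le> dim2 M"
  unfolding dim2_eq
proof (rule Liminf_bounded)
  show "\<forall>\<^sub>F n in sequentially. ereal r \<le> ereal (ln (dyadic_sum n M) / ln (1 / 2 ^ n))"
    using assms eventually_gt_at_top[of 0] by eventually_elim (simp add: local_dim_iff)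
qed

lemma (in real_distribution) dim2_nonneg: "0 \<le> dim2 M"
  using dim2_geI[of 0] dyadic_sum_le_1 dyadic_sum_pos[THEN less_imp_neq, THEN not_sym] by (simp add: zero_ereal_def)

text \<open>A scale-by-scale inequality becomes an inequality of dimensions: the first term gains $\alpha$ over the
dimension of $\nu$, the second decays at rate $\beta$, and any $r$ below both rates leaves
room to absorb the constants.\<close>

lemma dim2_less_of_dyadic_sum_le:
  assumes \<nu>: "real_distribution \<nu>" and \<sigma>: "real_distribution \<sigma>"
    and le: "\<And>n. dyadic_sum n \<sigma> \<le> A * 2 powr (- \<alpha> * real n) * dyadic_sum n \<nu> + B * 2 powr (- \<beta> * real n)"
    and AB: "0 \<le> A" "0 \<le> B"
    and s: "dim2 \<nu> = ereal s" and r: "r < s + \<alpha>" "r < \<beta>"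
  shows "ereal r < dim2 \<sigma>"
proof -
  interpret \<nu>: real_distribution \<nu> by fact
  interpret \<sigma>: real_distribution \<sigma> by fact
  obtain r1 where r1: "r < r1" "r1 < min (s + \<alpha>) \<beta>"
    using dense[of r "min (s + \<alpha>) \<beta>"] r by auto
  obtain r2 where r2: "r < r2" "r2 < r1"
    using dense[OF r1(1)] by auto
  have "ereal (r1 - \<alpha>) < dim2 \<nu>"
    using r1 s by simp
  then have ev1: "\<forall>\<^sub>F n in sequentially. dyadic_sum n \<nu> < 2 powr (- (r1 - \<alpha>) * real n)"
    by (rule \<nu>.dim2_gtD)
  have ev2: "\<forall>\<^sub>F n in sequentially. A + B \<le> 2 powr ((r1 - r2) * real n)"
  proof -
    have c: "0 < (r1 - r2) * ln 2"
      using r2 by simp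
    have "\<forall>\<^sub>F n in sequentially. (A + B) / ((r1 - r2) * ln 2) \<le> real n"
      using filterlim_real_sequentially by (simp add: filterlim_at_top)
    then show ?thesis
    proof eventually_elim
      case (elim n)
      then have "A + B \<le> (r1 - r2) * ln 2 * real n"
        using c by (simp add: pos_divide_le_eq mult.commute)
      also have "\<dots> \<le> exp ((r1 - r2) * ln 2 * real n)"
        using exp_ge_add_one_self[of "(r1 - r2) * ln 2 * real n"] by linarith
      finally show ?case
        by (simp add: powr_def mult_ac)
    qed
  qed
  have "\<forall>\<^sub>F n in sequentially. dyadic_sum n \<sigma> \<le> 2 powr (- r2 * real n)"
    using ev1 ev2
  proof eventually_elim
    case (elim n)
    have "A * 2 powr (- \<alpha> * real n) * dyadic_sum n \<nu> \<le> A * 2 powr (- \<alpha> * real n) * 2 powr (- (r1 - \<alpha>) * real n)"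
      using elim AB by (intro mult_left_mono) auto
    also have "\<dots> = A * 2 powr (- r1 * real n)"
      by (simp add: mult.assoc powr_add[symmetric]) (simp add: algebra_simps)
    finally have 1: "A * 2 powr (- \<alpha> * real n) * dyadic_sum n \<nu> \<le> A * 2 powr (- r1 * real n)" .
    have 2: "B * 2 powr (- \<beta> * real n) \<le> B * 2 powr (- r1 * real n)"
      using r1 AB by (intro mult_left_mono powr_mono) (auto intro!: mult_right_mono)
    have "dyadic_sum n \<sigma> \<le> (A + B) * 2 powr (- r1 * real n)"
      using le[of n] 1 2 by (simp add: distrib_right)
    also have "\<dots> \<le> 2 powr ((r1 - r2) * real n) * 2 powr (- r1 * real n)"
      using elim by (intro mult_right_mono) auto
    also have "\<dots> = 2 powr (- r2 * real n)"
      by (simp add: powr_add[symmetric]) (simp add: algebra_simps)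
    finally show ?case .
  qed
  then have "ereal r2 \<le> dim2 \<sigma>"
    by (rule \<sigma>.dim2_geI)
  with r2 show ?thesis
    by (meson ereal_less_eq(3) less_ereal.simps(1) less_le_trans)
qed

section \<open>Scales at which a frequency is far from the integers\<close>

text \<open>The radius is half of $c = a/(1+a)$. It is chosen so that $c/a = 1-c$: a neighbourhood magnified by
$1/a$ is exactly as long as the gap between two neighbourhoods.\<close>

definition near_int :: "real \<Rightarrow> real \<Rightarrow> bool" where
  "near_int a y \<longleftrightarrow> (\<exists>k::int. \<bar>y - of_int k\<bar> < a / (2 * (1 + a)))"

text \<open>The number of $j < k$ for which $y/a^j$ is far from the integers. With $y = a^N\xi$ and $k = N$ these are the
points $a\xi,\dots,a^N\xi$.\<close>

primrec far_count :: "real \<Rightarrow> nat \<Rightarrow> real \<Rightarrow> nat" where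
  "far_count a 0 y = 0"
| "far_count a (Suc k) y = (if near_int a y then 0 else 1) + far_count a k (y / a)"

lemma near_int_width: "2 * (a / (2 * (1 + a))) = a / (1 + a :: real)"
  unfolding times_divide_eq_right by (rule mult_divide_mult_cancel_left) simp

lemma near_int_measurable [measurable]: "Measurable.pred borel (near_int a)"
  unfolding near_int_def by measurable

lemma far_count_measurable [measurable]: "far_count a k \<in> measurable borel (count_space UNIV)"
proof (induction k)
  case 0
  then show ?case by simp
next
  case (Suc k)
  note Suc [measurable]
  have [measurable]: "(\<lambda>y. far_count a k (y / a)) \<in> measurable borel (count_space UNIV)"
    by (rule measurable_compose[OF _ Suc]) simp
  show ?case
    by simp
qed

lemma nn_integral_interval_cover:
  fixes f :: "real \<Rightarrow> ennreal" and l :: real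
  assumes [measurable]: "f \<in> borel_measurable borel"
    and B: "\<And>b. (\<integral>\<^sup>+y. f y * indicator {b..<b + l} y \<partial>lborel) \<le> B"
    and r: "r \<le> real m * l"
  shows "(\<integral>\<^sup>+y. f y * indicator {b..<b + r} y \<partial>lborel) \<le> of_nat m * B"
proof -
  have "(\<integral>\<^sup>+y. f y * indicator {b..<b + real m * l} y \<partial>lborel) \<le> of_nat m * B"
  proof (induction m)
    case 0
    then show ?case by simp
  next
    case (Suc m)
    have "(\<integral>\<^sup>+y. f y * indicator {b..<b + real (Suc m) * l} y \<partial>lborel)
        \<le> (\<integral>\<^sup>+y. f y * indicator {b..<b + real m * l} y
              + f y * indicator {b + real m * l..<(b + real m * l) + l} y \<partial>lborel)"
      by (intro nn_integral_mono) (auto simp: indicator_def algebra_simps)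
    also have "\<dots> \<le> of_nat m * B + B"
      by (subst nn_integral_add) (auto intro!: add_mono Suc B)
    finally show ?case
      by (simp add: algebra_simps)
  qed
  moreover have "(\<integral>\<^sup>+y. f y * indicator {b..<b + r} y \<partial>lborel)
      \<le> (\<integral>\<^sup>+y. f y * indicator {b..<b + real m * l} y \<partial>lborel)"
    using r by (intro nn_integral_mono) (auto simp: indicator_def)
  ultimately show ?thesis
    by (rule order_trans[rotated])
qed

lemma nn_integral_interval_rescale:
  fixes f :: "real \<Rightarrow> ennreal" and a :: real
  assumes [measurable]: "f \<in> borel_measurable borel" and "0 < a"
  shows "(\<integral>\<^sup>+y. f (y / a) * indicator {b..<b + r} y \<partial>lborel)
       = ennreal a * (\<integral>\<^sup>+y. f y * indicator {b / a..<b / a + r / a} y \<partial>lborel)"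
proof -
  have "(\<integral>\<^sup>+y. f (y / a) * indicator {b..<b + r} y \<partial>lborel)
      = ennreal \<bar>a\<bar> * (\<integral>\<^sup>+y. f ((0 + a * y) / a) * indicator {b..<b + r} (0 + a * y) \<partial>lborel)"
    using \<open>0 < a\<close> by (intro nn_integral_real_affine) auto
  also have "(\<lambda>y. f ((0 + a * y) / a) * indicator {b..<b + r} (0 + a * y))
      = (\<lambda>y. f y * indicator {b / a..<b / a + r / a} y)"
    using \<open>0 < a\<close> by (auto simp: indicator_def field_simps fun_eq_iff)
  finally show ?thesis
    using \<open>0 < a\<close> by simp
qed

text \<open>Two points near different integers are more than a gap, of length $1/(1+a)$, apart.\<close>

lemma near_int_unique:
  assumes "0 < a" 
  shows "\<exists>k::int. \<forall>y\<in>{b..<b + 1 / (1 + a)}. near_int a y \<longrightarrow> \<bar>y - of_int k\<bar> < a / (2 * (1 + a))"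
proof (cases "\<exists>y\<in>{b..<b + 1 / (1 + a)}. near_int a y")
  case True
  then obtain y k where y: "y \<in> {b..<b + 1 / (1 + a)}" "\<bar>y - of_int k\<bar> < a / (2 * (1 + a))"
    by (auto simp: near_int_def)
  have "\<bar>y' - of_int k\<bar> < a / (2 * (1 + a))"
    if y': "y' \<in> {b..<b + 1 / (1 + a)}" "near_int a y'" for y'
  proof -
    obtain k' :: int where k': "\<bar>y' - of_int k'\<bar> < a / (2 * (1 + a))"
      using y' by (auto simp: near_int_def)
    have "\<bar>y - y'\<bar> < 1 / (1 + a)"
      using y y' by auto
    moreover define h g where "h = a / (2 * (1 + a))" and "g = 1 / (1 + a)"
    moreover have "2 * h + g = 1"
    proof -
      have "2 * h = a / (1 + a)"
        unfolding h_def by (rule near_int_width)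
      then have "2 * h + g = (a + 1) / (1 + a)"
        by (simp only: g_def add_divide_distrib)
      then show ?thesis
        using assms by (simp add: add.commute)
    qed
    ultimately have "\<bar>of_int k - of_int k' :: real\<bar> < 1"
      using k' y(2) unfolding h_def[symmetric] g_def[symmetric] by linarith
    then have "k = k'"
      by linarith
    with k' show ?thesis by simp
  qed
  then show ?thesis by blast
qed auto

text \<open>Induction on the number of scales. Of an interval of length $1/(1+a)$, the part near the integers lies in one
neighbourhood and magnifies to one interval of the same length. The whole interval magnifies to
length $1/(a(1+a))$, covered by $\lceil 1/a\rceil$ of them, and enters with the factor $l$.\<close>

lemma far_count_integral_le:
  assumes a: "0 < a" "a < 1" and l: "0 < l" "l \<le> 1"
  shows "(\<integral>\<^sup>+y. ennreal (l ^ far_count a k y) * indicator {b..<b + 1 / (1 + a)} y \<partial>lborel)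
       \<le> ennreal (1 / (1 + a) * (a * (1 + l * of_int \<lceil>1 / a\<rceil>)) ^ k)"
proof (induction k arbitrary: b)
  case 0
  then show ?case
    using a by (simp add: nn_integral_cmult_indicator)
next
  case (Suc k)
  define f where "f = (\<lambda>y. ennreal (l ^ far_count a k y))"
  define B where "B = 1 / (1 + a) * (a * (1 + l * of_int \<lceil>1 / a\<rceil>)) ^ k"
  define m where "m = nat \<lceil>1 / a\<rceil>"
  have m: "of_int \<lceil>1 / a\<rceil> = real m" "1 / a \<le> real m"
    using a by (simp_all add: m_def)
  have [measurable]: "f \<in> borel_measurable borel"
    unfolding f_def by measurable
  have IH: "(\<integral>\<^sup>+y. f y * indicator {b..<b + 1 / (1 + a)} y \<partial>lborel) \<le> ennreal B" for b
    using Suc.IH by (simp add: f_def B_def)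
  have B0: "0 \<le> B"
    using a l m by (auto simp: B_def intro!: mult_nonneg_nonneg divide_nonneg_nonneg)
  obtain j :: int where j: "\<And>y. y \<in> {b..<b + 1 / (1 + a)} \<Longrightarrow> near_int a y \<Longrightarrow> \<bar>y - of_int j\<bar> < a / (2 * (1 + a))"
    using near_int_unique[OF a(1)] by metis
  define s where "s = of_int j - a / (2 * (1 + a))"
  have s: "y \<in> {s..<s + a / (1 + a)}" if "y \<in> {b..<b + 1 / (1 + a)}" "near_int a y" for y
  proof -
    show ?thesis
      using j[OF that] near_int_width[of a] by (simp add: s_def abs_less_iff)
  qed
  \<comment> \<open>Far points pay the factor $l$; near points lie in the neighbourhood $[s, s+a/(1+a))$ of $j$.\<close>
  have "ennreal (l ^ far_count a (Suc k) y) * indicator {b..<b + 1 / (1 + a)} y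
      \<le> f (y / a) * indicator {s..<s + a / (1 + a)} y
        + ennreal l * (f (y / a) * indicator {b..<b + 1 / (1 + a)} y)" for y
    using s[of y] l by (auto simp: f_def indicator_def ennreal_mult[symmetric])
  then have "(\<integral>\<^sup>+y. ennreal (l ^ far_count a (Suc k) y) * indicator {b..<b + 1 / (1 + a)} y \<partial>lborel)
      \<le> (\<integral>\<^sup>+y. f (y / a) * indicator {s..<s + a / (1 + a)} y
        + ennreal l * (f (y / a) * indicator {b..<b + 1 / (1 + a)} y) \<partial>lborel)"
    by (intro nn_integral_mono) 
  also have "\<dots> = ennreal a * (\<integral>\<^sup>+y. f y * indicator {s / a..<s / a + 1 / (1 + a)} y \<partial>lborel)
        + ennreal l * (ennreal a * (\<integral>\<^sup>+y. f y * indicator {b / a..<b / a + 1 / (1 + a) / a} y \<partial>lborel))"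
    using a by (simp add: nn_integral_add nn_integral_cmult nn_integral_interval_rescale)
  also have "\<dots> \<le> ennreal a * ennreal B + ennreal l * (ennreal a * (of_nat m * ennreal B))"
  proof (intro add_mono mult_left_mono IH nn_integral_interval_cover)
    show "1 / (1 + a) / a \<le> real m * (1 / (1 + a))"
      using mult_right_mono[OF m(2), of "1 / (1 + a)"] a by (simp add: mult.commute)
  qed (use IH in auto)
  also have "\<dots> = ennreal (1 / (1 + a) * (a * (1 + l * of_int \<lceil>1 / a\<rceil>)) ^ Suc k)"
    using a l B0
    by (simp add: ennreal_of_nat_eq_real_of_nat ennreal_mult[symmetric] ennreal_plus[symmetric] m del: ennreal_plus)
       (simp add: B_def m algebra_simps add_divide_distrib)
  finally show ?case .
qed

text \<open>For $n \ge x$ the first term bounds the left-hand side. For $n < x$ the second term $l^{n-x}$ is at least 1, as in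
Chernoff's bound.\<close>

lemma far_count_power_le:
  fixes \<rho> l x :: real
  assumes "0 < \<rho>" "\<rho> < 1" "0 < l" "l \<le> 1" 
  shows "(\<rho> ^ n)\<^sup>2 \<le> \<rho> powr (2 * x) + l powr (- x) * l ^ n"
proof (cases "real n \<ge> x")
  case True
  have "(\<rho> ^ n)\<^sup>2 = \<rho> powr (2 * real n)"
    using assms by (simp add: powr_realpow[symmetric] powr_powr mult.commute power2_eq_square powr_add[symmetric])
  also have "\<dots> \<le> \<rho> powr (2 * x)"
    using True assms by (intro powr_mono') auto
  also have "\<dots> \<le> \<rho> powr (2 * x) + l powr (- x) * l ^ n"
    using assms by simp
  finally show ?thesis .
next
  case False
  have "(\<rho> ^ n)\<^sup>2 \<le> 1"
    using assms by (simp add: power_le_one power_mult[symmetric])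
  also have "1 \<le> l powr (real n - x)"
    using False assms powr_mono'[of "real n - x" 0 l] by simp
  also have "\<dots> = l powr (- x) * l ^ n"
    using assms by (simp add: powr_realpow[symmetric] powr_add[symmetric])
  also have "\<dots> \<le> \<rho> powr (2 * x) + l powr (- x) * l ^ n"
    by simp
  finally show ?thesis .
qed

section \<open>The characteristic function of a self-similar measure\<close>

lemma char_convolution:
  assumes "real_distribution M" "real_distribution N"
  shows "char (convolution M N) u = char M u * char N u"
proof -
  interpret M: real_distribution M by fact
  interpret N: real_distribution N by fact
  interpret pair_sigma_finite M N ..
  interpret P: pair_prob_space M N ..
  have "char (convolution M N) u = (\<integral>z. iexp (u * (fst z + snd z)) \<partial>(M \<Otimes>\<^sub>M N))"
    unfolding char_def convolution_def by (subst integral_distr) (auto simp: case_prod_beta)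
  also have "\<dots> = (\<integral>x. \<integral>y. iexp (u * (x + y)) \<partial>N \<partial>M)"
    by (subst integral_fst'[symmetric]) (auto intro!: P.integrable_iexp)
  also have "\<dots> = (\<integral>x. iexp (u * x) * char N u \<partial>M)"
    by (simp add: char_def distrib_left exp_add)
  also have "\<dots> = char M u * char N u"
    by (simp add: char_def)
  finally show ?thesis .
qed

lemma real_distribution_convolution:
  assumes "real_distribution M" "real_distribution N"
  shows "real_distribution (convolution M N)"
proof -
  interpret M: real_distribution M by fact
  interpret N: real_distribution N by fact
  interpret P: pair_prob_space M N ..
  show ?thesis
    unfolding convolution_def by (intro P.real_distribution_distr) auto
qed

lemma one_minus_eta_bounds:
  assumes a: "0 < a" "a < 1" and m: "2 \<le> m"
    and pos: "\<And>i. i \<in> {1..m} \<Longrightarrow> 0 < p i" and one: "(\<Sum>i=1..m. p i) = 1"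
  shows "0 < 1 - eta (a / (a + 1)) p" "1 - eta (a / (a + 1)) p < 1"
proof -
  have p12: "0 < p 1" "0 < p 2"
    using pos[of 1] pos[of 2] m by auto
  have "(\<Sum>i\<in>{1, 2}. p i) \<le> (\<Sum>i=1..m. p i)"
    using m pos by (intro sum_mono2) (auto simp: less_imp_le)
  then have p: "0 < p 1" "0 < p 2" "p 1 + p 2 \<le> 1"
    using p12 one by simp_all
  let ?x = "pi * (a / (a + 1))"
  have "a / (a + 1) < 1 / 2"
    using a by (simp add: field_simps)
  then have lt: "?x < pi * (1 / 2)"
    by (intro mult_strict_left_mono) auto
  have x0: "0 < ?x"
    using a by auto
  have c0: "0 < cos ?x"
    using lt x0 by (intro cos_gt_zero) auto
  have c1: "cos ?x < 1"
  proof -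
    have "?x \<le> pi"
      using lt pi_gt_zero by linarith
    then show ?thesis
      using cos_monotone_0_pi[of 0 ?x] x0 by simp
  qed
  have "0 < (p 1)\<^sup>2 + 2 * p 1 * p 2 * cos ?x + (p 2)\<^sup>2"
    using p c0 by (intro add_pos_pos mult_pos_pos) auto
  then have "0 < sqrt ((p 1)\<^sup>2 + 2 * p 1 * p 2 * cos ?x + (p 2)\<^sup>2)"
    by (rule real_sqrt_gt_zero)
  then show "0 < 1 - eta (a / (a + 1)) p"
    using p unfolding eta_def by linarith
  have "2 * p 1 * p 2 * cos ?x < 2 * p 1 * p 2 * 1"
    using p c1 by (intro mult_strict_left_mono) auto
  then have "(p 1)\<^sup>2 + 2 * p 1 * p 2 * cos ?x + (p 2)\<^sup>2 < (p 1 + p 2)\<^sup>2"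
    by (simp add: power2_eq_square algebra_simps)
  then have "sqrt ((p 1)\<^sup>2 + 2 * p 1 * p 2 * cos ?x + (p 2)\<^sup>2) < p 1 + p 2"
    using p by (intro real_less_lsqrt) auto
  then show "1 - eta (a / (a + 1)) p < 1"
    unfolding eta_def by linarith
qed

context
  fixes m :: nat and p :: "nat \<Rightarrow> real" and t :: "nat \<Rightarrow> real" and a :: real
  assumes p: "\<And>i. i \<in> {1..m} \<Longrightarrow> 0 < p i" "(\<Sum>i=1..m. p i) = 1"
    and a: "0 < a" "a < 1"
begin

lemma digit_law_real_distribution: "real_distribution (digit_law m p t)"
proof -
  have "prob_space (point_measure {1..m} (\<lambda>i. ennreal (p i)))"
  proof (rule prob_spaceI)
    have "(\<Sum>i=1..m. ennreal (p i)) = ennreal (\<Sum>i=1..m. p i)"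
      by (intro sum_ennreal less_imp_le p(1))
    then show "emeasure (point_measure {1..m} (\<lambda>i. ennreal (p i)))
        (space (point_measure {1..m} (\<lambda>i. ennreal (p i)))) = 1"
      by (simp only: space_point_measure emeasure_point_measure_finite[OF finite_atLeastAtMost order_refl] p(2) ennreal_1)
  qed
  then interpret P: prob_space "point_measure {1..m} (\<lambda>i. ennreal (p i))" .
  show ?thesis
    unfolding digit_law_def by (rule P.real_distribution_distr) simp
qed

lemma char_digit_law: "char (digit_law m p t) u = (\<Sum>i=1..m. of_real (p i) * iexp (u * t i))"
  unfolding char_def digit_law_def
  by (subst integral_distr, simp, simp, subst lebesgue_integral_point_measure_finite)
     (use p(1) in \<open>auto simp: scaleR_conv_of_real less_imp_le\<close>)

lemma digit_law_bounded: "AE x in digit_law m p t. \<bar>x\<bar> \<le> (\<Sum>i=1..m. \<bar>t i\<bar>)"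
  unfolding digit_law_def
  by (subst AE_distr_iff)
     (auto intro!: AE_I2 member_le_sum[of _ _ "\<lambda>i. \<bar>t i\<bar>"] simp: space_point_measure)

lemma self_similar_measure_real_distribution:
  "real_distribution (self_similar_measure m a p t)"
proof -
  interpret D: real_distribution "digit_law m p t" by (rule digit_law_real_distribution)
  interpret P: prob_space "\<Pi>\<^sub>M n\<in>(UNIV :: nat set). digit_law m p t"
    by (intro prob_space_PiM D.prob_space_axioms)
  show ?thesis
    unfolding self_similar_measure_def by (intro P.real_distribution_distr) measurable
qed

text \<open>The tail of the random series is an independent copy of the whole series times $a$. The head can be split off
because the digits are almost surely bounded, so that the series converges almost surely.\<close>

lemma char_self_similar_measure:
  "char (self_similar_measure m a p t) u
     = char (digit_law m p t) (a * u) * char (self_similar_measure m a p t) (a * u)"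
proof -
  let ?D = "digit_law m p t"
  interpret D: real_distribution "digit_law m p t" by (rule digit_law_real_distribution)
  interpret S: sequence_space ?D ..
  interpret D_S: pair_prob_space ?D S.S ..
  define s where "s = (\<lambda>x :: nat \<Rightarrow> real. \<Sum>n. x n * a ^ (n + 1))"
  have s_meas [measurable]: "s \<in> borel_measurable S.S"
    unfolding s_def by measurable
  have [measurable]: "(\<lambda>(x, \<omega>). case_nat x \<omega>) \<in> measurable (?D \<Otimes>\<^sub>M S.S) S.S"
    by measurable
  have bounded: "AE \<omega> in S.S. \<forall>n. \<bar>\<omega> n\<bar> \<le> (\<Sum>i=1..m. \<bar>t i\<bar>)"
    by (intro AE_all_countable[THEN iffD2] allI AE_PiM_component digit_law_bounded D.prob_space_axioms) auto
  have head: "s (case_nat x \<omega>) = a * x + a * s \<omega>" if "\<forall>n. \<bar>\<omega> n\<bar> \<le> (\<Sum>i=1..m. \<bar>t i\<bar>)" for x \<omega>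
  proof -
    have sm: "summable (\<lambda>n. \<omega> n * a ^ (n + 1))"
    proof (rule summable_comparison_test')
      show "summable (\<lambda>n. (\<Sum>i=1..m. \<bar>t i\<bar>) * a ^ (n + 1))"
        using a by (intro summable_mult) (simp add: summable_mult)
      show "norm (\<omega> n * a ^ (n + 1)) \<le> (\<Sum>i=1..m. \<bar>t i\<bar>) * a ^ (n + 1)" if "n \<ge> 0" for n
        using a \<open>\<forall>n. _\<close> by (auto simp: abs_mult intro!: mult_right_mono)
    qed
    have sm': "(\<lambda>n. case_nat x \<omega> (Suc n) * a ^ (Suc n + 1)) = (\<lambda>n. a * (\<omega> n * a ^ (n + 1)))"
      by (auto simp: fun_eq_iff)
    have "summable (\<lambda>n. case_nat x \<omega> n * a ^ (n + 1))"
      by (subst summable_Suc_iff[symmetric], subst sm') (intro summable_mult sm)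
    from suminf_split_head[OF this] show ?thesis
      unfolding s_def sm' using suminf_mult[OF sm, of a] by (simp add: algebra_simps)
  qed
  have char_s: "char (self_similar_measure m a p t) v = (\<integral>\<omega>. iexp (v * s \<omega>) \<partial>S.S)" for v
    unfolding char_def self_similar_measure_def s_def[symmetric] by (subst integral_distr) auto
  have "(\<integral>\<omega>. iexp (u * s \<omega>) \<partial>S.S) = (\<integral>\<omega>. iexp (u * s \<omega>) \<partial>(distr (?D \<Otimes>\<^sub>M S.S) S.S (\<lambda>(x, \<omega>). case_nat x \<omega>)))"
    by (subst S.PiM_iter) simp
  also have "\<dots> = (\<integral>z. iexp (u * s (case_nat (fst z) (snd z))) \<partial>(?D \<Otimes>\<^sub>M S.S))"
    by (subst integral_distr) (auto simp: case_prod_beta)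
  also have "\<dots> = (\<integral>x. \<integral>\<omega>. iexp (u * s (case_nat x \<omega>)) \<partial>S.S \<partial>?D)"
    by (subst D_S.integral_fst'[symmetric]) (auto intro!: D_S.P.integrable_iexp)
  also have "\<dots> = (\<integral>x. \<integral>\<omega>. iexp (u * (a * x + a * s \<omega>)) \<partial>S.S \<partial>?D)"
  proof (rule Bochner_Integration.integral_cong[OF refl])
    fix x
    have [measurable]: "(\<lambda>\<omega>. case_nat x \<omega>) \<in> measurable S.S S.S"
      by measurable
    show "(\<integral>\<omega>. iexp (u * s (case_nat x \<omega>)) \<partial>S.S) = (\<integral>\<omega>. iexp (u * (a * x + a * s \<omega>)) \<partial>S.S)"
    proof (rule integral_cong_AE)
      show "AE \<omega> in S.S. iexp (u * s (case_nat x \<omega>)) = iexp (u * (a * x + a * s \<omega>))"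
        using bounded by eventually_elim (subst head, assumption, rule refl)
    qed measurable
  qed
  also have "\<dots> = (\<integral>x. iexp (a * u * x) * (\<integral>\<omega>. iexp (a * u * s \<omega>) \<partial>S.S) \<partial>?D)"
    by (simp add: distrib_left exp_add mult_ac)
  also have "\<dots> = char ?D (a * u) * (\<integral>\<omega>. iexp (a * u * s \<omega>) \<partial>S.S)"
    by (simp add: char_def)
  finally show ?thesis
    by (simp add: char_s)
qed

lemma cmod_char_digit_law_le_1: "cmod (char (digit_law m p t) u) \<le> 1"
proof -
  interpret D: real_distribution "digit_law m p t" by (rule digit_law_real_distribution)
  show ?thesis by (rule D.cmod_char_le_1)
qed

text \<open>The first two digits contribute $|p_1 + p_2 e^{2\pi i y}|$, which decreases in the distance of $y$ from
the integers; the remaining digits contribute at most their total weight.\<close>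

lemma cmod_char_digit_law_far:
  assumes m: "2 \<le> m" and t: "t 1 = 0" "t 2 = 1" and far: "\<not> near_int a y"
  shows "cmod (char (digit_law m p t) (2 * pi * y)) \<le> 1 - eta (a / (a + 1)) p"
proof -
  have p12: "0 < p 1" "0 < p 2"
    using p(1)[of 1] p(1)[of 2] m by auto
  define r where "r = y - of_int (round y)"
  have r: "\<bar>r\<bar> \<le> 1 / 2" "a / (2 * (1 + a)) \<le> \<bar>r\<bar>"
    using of_int_round_abs_le[of y] far by (auto simp: r_def near_int_def abs_minus_commute not_less)
  have "cos (2 * pi * y) = cos (2 * pi * r + 2 * pi * of_int (round y))"
    by (simp add: r_def algebra_simps)
  also have "\<dots> = cos (2 * pi * r)"
    by (simp only: cos_add cos_int_2pin sin_int_2pin mult_1_right mult_zero_right diff_zero)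
  also have "\<dots> = cos (2 * pi * \<bar>r\<bar>)"
    by (simp add: abs_if)
  also have "\<dots> \<le> cos (pi * (a / (a + 1)))"
  proof (rule cos_monotone_0_pi_le)
    have "pi * (a / (a + 1)) = 2 * pi * (a / (2 * (1 + a)))"
      using near_int_width[of a] by (simp only: add.commute[of a 1] mult_ac)
    also have "\<dots> \<le> 2 * pi * \<bar>r\<bar>"
      using r(2) by (intro mult_left_mono) auto
    finally show "pi * (a / (a + 1)) \<le> 2 * pi * \<bar>r\<bar>" .
    show "2 * pi * \<bar>r\<bar> \<le> pi"
      using r(1) by simp
  qed (use a in auto)
  finally have cos_le: "cos (2 * pi * y) \<le> cos (pi * (a / (a + 1)))" .
  have "cmod (of_real (p 1) + of_real (p 2) * iexp (2 * pi * y))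
      = sqrt ((p 1 + p 2 * cos (2 * pi * y))\<^sup>2 + (p 2 * sin (2 * pi * y))\<^sup>2)"
    by (simp add: cmod_def Re_exp Im_exp)
  also have "(p 1 + p 2 * cos (2 * pi * y))\<^sup>2 + (p 2 * sin (2 * pi * y))\<^sup>2
      = (p 1)\<^sup>2 + 2 * p 1 * p 2 * cos (2 * pi * y) + (p 2)\<^sup>2 * ((sin (2 * pi * y))\<^sup>2 + (cos (2 * pi * y))\<^sup>2)"
    by algebra
  also have "sqrt \<dots> \<le> sqrt ((p 1)\<^sup>2 + 2 * p 1 * p 2 * cos (pi * (a / (a + 1))) + (p 2)\<^sup>2)"
    using cos_le p12 by simp
  finally have two: "cmod (of_real (p 1) + of_real (p 2) * iexp (2 * pi * y)) \<le> p 1 + p 2 - eta (a / (a + 1)) p"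
    by (simp add: eta_def)
  have split: "{1..m} = insert 1 (insert 2 {3..m})"
    using m by auto
  have "(\<Sum>i=1..m. of_real (p i) * iexp (2 * pi * y * t i))
      = (of_real (p 1) + of_real (p 2) * iexp (2 * pi * y)) + (\<Sum>i=3..m. of_real (p i) * iexp (2 * pi * y * t i))"
    unfolding split using t by simp
  then have "cmod (char (digit_law m p t) (2 * pi * y))
      \<le> cmod (of_real (p 1) + of_real (p 2) * iexp (2 * pi * y)) + cmod (\<Sum>i=3..m. of_real (p i) * iexp (2 * pi * y * t i))"
    unfolding char_digit_law by (simp only: norm_triangle_ineq)
  also have "cmod (\<Sum>i=3..m. of_real (p i) * iexp (2 * pi * y * t i)) \<le> (\<Sum>i=3..m. p i)"
  proof (rule sum_norm_le)
    fix i assume "i \<in> {3..m}"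
    then show "cmod (of_real (p i) * iexp (2 * pi * y * t i)) \<le> p i"
      using p(1)[of i] by (simp add: norm_mult del: of_real_mult)
  qed
  also have "(\<Sum>i=3..m. p i) = 1 - p 1 - p 2"
    using p(2) unfolding split by simp
  finally show ?thesis
    using two by linarith
qed

text \<open>The induction step consumes the factor $|\hat\mu(2\pi y)|$: the count peels off the lowest
frequency $y$, and self-similarity at $2\pi y/a$ extracts the digit at $2\pi y$ from $|\hat\mu(2\pi y/a)|$, the factor
left over from the other scales.\<close>

lemma cmod_char_self_similar_measure_le:
  assumes m: "2 \<le> m" and t: "t 1 = 0" "t 2 = 1"
  shows "cmod (char (self_similar_measure m a p t) (2 * pi * (y / a ^ N)))
       \<le> (1 - eta (a / (a + 1)) p) ^ far_count a N y * cmod (char (self_similar_measure m a p t) (2 * pi * y))"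
proof (induction N arbitrary: y)
  case 0
  then show ?case by simp
next
  case (Suc N)
  let ?f = "\<lambda>y. cmod (char (self_similar_measure m a p t) (2 * pi * y))"
  let ?\<rho> = "1 - eta (a / (a + 1)) p"
  have \<rho>: "0 \<le> ?\<rho>"
    using one_minus_eta_bounds(1)[OF a m p] by simp
  have "?f (y / a) = cmod (char (digit_law m p t) (2 * pi * y)) * ?f y"
    using char_self_similar_measure[of "2 * pi * (y / a)"] a by (simp add: norm_mult)
  also have "\<dots> \<le> ?\<rho> ^ (if near_int a y then 0 else 1) * ?f y"
    using cmod_char_digit_law_far[OF m t] cmod_char_digit_law_le_1 by (intro mult_right_mono) auto
  finally have step: "?f (y / a) \<le> ?\<rho> ^ (if near_int a y then 0 else 1) * ?f y" .
  have "?f (y / a ^ Suc N) \<le> ?\<rho> ^ far_count a N (y / a) * ?f (y / a)"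
    using Suc.IH[of "y / a"] by simp
  also have "\<dots> \<le> ?\<rho> ^ far_count a N (y / a) * (?\<rho> ^ (if near_int a y then 0 else 1) * ?f y)"
    using \<rho> by (intro mult_left_mono step) auto
  finally show ?case
    by (simp add: power_add mult_ac)
qed

end

section \<open>Choice of the exponents\<close>

lemma entropy_fun_nonneg: "0 < x \<Longrightarrow> x < 1 \<Longrightarrow> 0 \<le> entropy_fun x"
  unfolding entropy_fun_def by (smt (verit) ln_ge_zero_imp_ge_one mult_nonneg_nonpos ln_less_zero mult_minus_left)

text \<open>With $K = \lceil 1/a\rceil$ and $x = \tilde\varepsilon$ the right-hand side is the numerator of $\delta$. The minimum of
$\log(1+lK) - x\log l$ over $l > 0$ is $x\log K + h(x)$, attained at $l = x/((1-x)K)$, and it is below the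
right-hand side because $K < K+1$. If that minimiser exceeds 1, then $x > K/(K+1)$ and $l = 1$ suffices, since
$-\log(1-x) > \log(K+1)$. Both cases are strict, which allows an $x'$ slightly above $x$.\<close>

lemma exponent_gap:
  fixes K x :: real
  assumes x: "0 < x" "x < 1" and K: "1 \<le> K"
  shows "\<exists>l x'. 0 < l \<and> l \<le> 1 \<and> x < x' \<and> ln (1 + l * K) - x' * ln l < x * ln (K + 1) + entropy_fun x"
proof -
  have "\<exists>l. 0 < l \<and> l \<le> 1 \<and> ln (1 + l * K) - x * ln l < x * ln (K + 1) + entropy_fun x"
  proof (cases "x \<le> (1 - x) * K")
    case True
    define l where "l = x / ((1 - x) * K)"
    have l: "0 < l" "l \<le> 1"
      using x K True by (auto simp: l_def)
    have "1 + l * K = 1 / (1 - x)"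
      using x K by (simp add: l_def field_simps)
    then have "ln (1 + l * K) = - ln (1 - x)"
      using x by (simp add: ln_div)
    moreover have "ln l = ln x - ln (1 - x) - ln K"
      using x K by (simp add: l_def ln_div ln_mult)
    moreover have "x * ln K < x * ln (K + 1)"
      using x K by (intro mult_strict_left_mono) auto
    moreover have "x * (ln x - ln (1 - x) - ln K) = x * ln x - x * ln (1 - x) - x * ln K"
      by (simp add: algebra_simps)
    ultimately have "ln (1 + l * K) - x * ln l < x * ln (K + 1) + entropy_fun x"
      unfolding entropy_fun_def by (simp add: left_diff_distrib)
    with l show ?thesis by blast
  next
    case False
    have "(1 - x) * (K + 1) < 1"
      using False by (simp add: algebra_simps)
    then have "ln ((1 - x) * (K + 1)) < ln 1"
      using x K by (subst ln_less_cancel_iff) auto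
    then have "ln (K + 1) < - ln (1 - x)"
      using x K by (simp add: ln_mult)
    then have "(1 - x) * ln (K + 1) < (1 - x) * (- ln (1 - x))"
      using x by (intro mult_strict_left_mono) auto
    moreover have "0 < - (x * ln x)"
      using x by (simp add: mult_pos_neg)
    ultimately have "ln (1 + 1 * K) - x * ln 1 < x * ln (K + 1) + entropy_fun x"
      by (simp add: entropy_fun_def algebra_simps)
    then show ?thesis by (intro exI[of _ 1]) auto
  qed
  then obtain l where l: "0 < l" "l \<le> 1" "ln (1 + l * K) - x * ln l < x * ln (K + 1) + entropy_fun x"
    by blast
  define g where "g = x * ln (K + 1) + entropy_fun x - (ln (1 + l * K) - x * ln l)"
  define x' where "x' = x + g / (2 * (1 - ln l))"
  have L: "0 \<le> - ln l" "0 < g"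
    using l by (auto simp: g_def)
  have "(x' - x) * (- ln l) \<le> g / 2"
    using L by (simp add: x'_def field_simps)
  then have "ln (1 + l * K) - x' * ln l < x * ln (K + 1) + entropy_fun x"
    using L(2) unfolding g_def by (simp add: algebra_simps)
  moreover have "x < x'"
    using L by (simp add: x'_def)
  ultimately show ?thesis
    using l by blast
qed

lemma entropy_fun_tendsto_0: "(entropy_fun \<longlongrightarrow> 0) (at_right 0)"
  unfolding entropy_fun_def by real_asymp

text \<open>In terms of $x = \tilde\varepsilon$ the equation is $x\log\lceil 1+1/a\rceil + h(x) + 2xb = \kappa\log(1/a)$
with $b = -\log(1-\eta)$. The left-hand side tends to 0 at 0 and exceeds $\log(1/a)$ near 1, because
$\lceil 1+1/a\rceil > 1/a$.\<close>

lemma ex_admissible_eps: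
  assumes a: "0 < a" "a < 1" and \<rho>: "0 < 1 - eta (a / (a + 1)) p" "1 - eta (a / (a + 1)) p < 1"
    and \<kappa>: "0 < \<kappa>" "\<kappa> \<le> 1"
  shows "\<exists>\<epsilon>. admissible_eps a p \<kappa> \<epsilon>"
proof -
  define b where "b = - ln (1 - eta (a / (a + 1)) p)"
  define L where "L = ln (1 / a)"
  define K where "K = ln (real_of_int \<lceil>1 + 1 / a\<rceil>)"
  define f where "f = (\<lambda>x. x * K + entropy_fun x + 2 * x * b)"
  have b: "0 < b"
    using \<rho> by (simp add: b_def)
  have L: "0 < L" "ln a = - L"
    using a by (simp_all add: L_def ln_div)
  have "1 / a < real_of_int \<lceil>1 + 1 / a\<rceil>"
    using le_of_int_ceiling[of "1 + 1 / a"] by linarith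
  then have LK: "L < K"
    unfolding L_def K_def using a by (intro ln_strict_mono) auto
  \<comment> \<open>A point below 1 with $x_1 K > L$; it exists since $L < K$.\<close>
  define x1 where "x1 = (L / K + 1) / 2"
  have x1: "1 / 2 < x1" "x1 < 1" "L < x1 * K"
    using L LK by (auto simp: x1_def field_simps)
  have "\<kappa> * L \<le> L"
    using \<kappa> L by simp
  also have "\<dots> \<le> f x1"
    unfolding f_def using x1 b entropy_fun_nonneg[of x1] by (simp add: add_nonneg_nonneg add_increasing2)
  finally have f1: "\<kappa> * L \<le> f x1" .
  have "(f \<longlongrightarrow> 0 * K + 0 + 2 * 0 * b) (at_right 0)"
    unfolding f_def by (intro tendsto_intros entropy_fun_tendsto_0)
  then have "\<forall>\<^sub>F x in at_right 0. f x < \<kappa> * L"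
    using \<kappa> L by (intro order_tendstoD) auto
  moreover have "\<forall>\<^sub>F x in at_right 0. x \<in> {0<..<1 / 2 :: real}"
    by (rule eventually_at_right_real) simp
  ultimately have "\<forall>\<^sub>F x in at_right 0. f x < \<kappa> * L \<and> x \<in> {0<..<1 / 2}"
    by eventually_elim auto
  then obtain x0 where x0: "f x0 < \<kappa> * L" "0 < x0" "x0 < 1 / 2"
    using eventually_happens'[of "at_right (0::real)"] by (auto simp: trivial_limit_at_right_real)
  have "\<exists>x\<ge>x0. x \<le> x1 \<and> f x = \<kappa> * L"
  proof (rule IVT')
    show "continuous_on {x0..x1} f"
      unfolding f_def entropy_fun_def using x0 x1 by (intro continuous_intros) auto
  qed (use x0 x1 f1 in auto)
  then obtain x where x: "x0 \<le> x" "x \<le> x1" "f x = \<kappa> * L"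
    by blast
  define \<epsilon> where "\<epsilon> = x * b / L"
  have tilde: "eps_tilde \<epsilon> a p = x"
    using L b unfolding eps_tilde_def \<epsilon>_def L(2) by (simp add: b_def)
  have "\<kappa> - 2 * \<epsilon> = delta \<epsilon> a p"
    using x(3) L unfolding delta_def tilde K_def[symmetric] L_def[symmetric]
    unfolding \<epsilon>_def by (simp add: f_def field_simps)
  moreover have "0 < \<epsilon>"
    using x x0 b L by (simp add: \<epsilon>_def)
  ultimately have "admissible_eps a p \<kappa> \<epsilon>"
    using x x0 x1 by (simp add: admissible_eps_def tilde)
  then show ?thesis ..
qed

section \<open>Flattening under convolution\<close>

lemma ex_scale:
  fixes a T :: real
  assumes "0 < a" "a < 1" "1 \<le> T"
  shows "\<exists>N. 1 \<le> a ^ N * T \<and> a ^ N * T \<le> 1 / a"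
proof -
  obtain n where "a ^ n < 1 / T"
    using real_arch_pow_inv[of "1 / T" a] assms by auto
  then have "a ^ n * T < 1"
    using assms by (simp add: field_simps)
  then obtain N where "\<forall>i\<le>N. \<not> a ^ i * T < 1" "a ^ Suc N * T < 1"
    using ex_least_nat_less[of "\<lambda>n. a ^ n * T < 1" n] assms by auto
  then show ?thesis
    using assms by (intro exI[of _ N]) (auto simp: not_less field_simps)
qed

text \<open>The pointwise bound for $|\hat\mu|^2$ splits into a constant part, which multiplies the energy of $\nu$, and
a part that is integrated over all frequencies. The substitution $y = a^N T u/(2\pi)$ maps $[0,1)$ into
$[0,1/a)$, which a fixed number of intervals of length $1/(1+a)$ covers.\<close>

lemma energy_convolution_le:
  fixes a l x :: real and m :: nat and p :: "nat \<Rightarrow> real"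
  assumes a: "0 < a" "a < 1" and m: "2 \<le> m"
    and p: "\<And>i. i \<in> {1..m} \<Longrightarrow> 0 < p i" "(\<Sum>i=1..m. p i) = 1"
    and l: "0 < l" "l \<le> 1"
    and t: "t 1 = 0" "t 2 = 1" and \<nu>: "real_distribution \<nu>"
    and T: "1 \<le> a ^ N * T" "a ^ N * T \<le> 1 / a"
  defines "\<rho> \<equiv> 1 - eta (a / (a + 1)) p"
  shows "energy T (convolution (self_similar_measure m a p t) \<nu>)
      \<le> \<rho> powr (2 * (x * real N)) * energy T \<nu>
        + 4 * pi * (real (nat \<lceil>(1 + a) / a\<rceil>) / (1 + a)) * (l powr (- (x * real N)) * (a * (1 + l * of_int \<lceil>1 / a\<rceil>)) ^ N)"
proof -
  let ?\<mu> = "self_similar_measure m a p t"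
  interpret \<mu>: real_distribution ?\<mu>
    using self_similar_measure_real_distribution[of m p a t] p a by auto
  interpret \<nu>: real_distribution \<nu> by fact
  have \<rho>: "0 < \<rho>" "\<rho> < 1"
    using one_minus_eta_bounds[OF a m p] by (simp_all add: \<rho>_def)
  define s where "s = a ^ N * T / (2 * pi)"
  have s: "1 / s \<le> 2 * pi" "0 < s" "s \<le> 1 / a"
  proof -
    have "0 < a ^ N * T" using T by linarith
    then show "0 < s" by (simp add: s_def)
    show "1 / s \<le> 2 * pi"
      using T(1) \<open>0 < a ^ N * T\<close> by (simp add: s_def field_simps)
    have "s \<le> a ^ N * T / 1"
      unfolding s_def using \<open>0 < a ^ N * T\<close> pi_gt3 by (intro divide_left_mono) auto
    then show "s \<le> 1 / a" using T(2) by simp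
  qed
  define b where "b = (\<lambda>u. far_count a N (s * u))"
  have [measurable]: "b \<in> measurable borel (count_space UNIV)"
    unfolding b_def by measurable
  define R where "R = \<rho> powr (2 * (x * real N))"
  define Q where "Q = l powr (- (x * real N))"
  have \<mu>_le: "(cmod (char ?\<mu> (T * u)))\<^sup>2 \<le> R + Q * l ^ b u" for u
  proof -
    have "T * u = 2 * pi * ((s * u) / a ^ N)"
      using a by (simp add: s_def)
    then have "cmod (char ?\<mu> (T * u)) \<le> \<rho> ^ b u * cmod (char ?\<mu> (2 * pi * (s * u)))"
      unfolding b_def \<rho>_def using cmod_char_self_similar_measure_le[OF p a m t] by simp
    also have "\<dots> \<le> \<rho> ^ b u * 1"
      using \<rho> by (intro mult_left_mono \<mu>.cmod_char_le_1) auto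
    finally have "(cmod (char ?\<mu> (T * u)))\<^sup>2 \<le> (\<rho> ^ b u)\<^sup>2"
      by (intro power_mono) auto
    also have "\<dots> \<le> R + Q * l ^ b u"
      unfolding R_def Q_def by (rule far_count_power_le[OF \<rho> l])
    finally show ?thesis .
  qed
  have RQ: "0 \<le> R" "0 \<le> Q"
    by (simp_all add: R_def Q_def)
  have sq1: "(cmod (char \<nu> v))\<^sup>2 \<le> 1" for v
    using \<nu>.cmod_char_le_1[of v] by (simp add: power_le_one)
  have int\<nu>: "integrable triangle_law (\<lambda>u. (cmod (char \<nu> (T * u)))\<^sup>2)"
    by (rule triangle_law.integrable_const_bound[where B=1]) (auto simp: sq1)
  have l1: "l ^ k \<le> 1" for k
    using l by (intro power_le_one) auto
  have intb: "integrable triangle_law (\<lambda>u. l ^ b u)"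
    by (rule triangle_law.integrable_const_bound[where B=1]) (use l in \<open>auto simp: l1 abs_le_iff\<close>)
  have "energy T (convolution ?\<mu> \<nu>) = (\<integral>u. (cmod (char ?\<mu> (T * u)))\<^sup>2 * (cmod (char \<nu> (T * u)))\<^sup>2 \<partial>triangle_law)"
    unfolding energy_def
    by (simp add: char_convolution[OF \<mu>.real_distribution_axioms \<nu>] norm_mult power_mult_distrib)
  also have "\<dots> \<le> (\<integral>u. R * (cmod (char \<nu> (T * u)))\<^sup>2 + Q * l ^ b u \<partial>triangle_law)"
  proof (rule integral_mono)
    have "(cmod (char ?\<mu> v))\<^sup>2 \<le> 1" for v
      using \<mu>.cmod_char_le_1[of v] by (simp add: power_le_one)
    then show "integrable triangle_law (\<lambda>u. (cmod (char ?\<mu> (T * u)))\<^sup>2 * (cmod (char \<nu> (T * u)))\<^sup>2)"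
      by (intro triangle_law.integrable_const_bound[where B=1]) (auto simp: sq1 intro!: mult_le_one)
    show "integrable triangle_law (\<lambda>u. R * (cmod (char \<nu> (T * u)))\<^sup>2 + Q * l ^ b u)"
      using int\<nu> intb by auto
    fix u
    have "(cmod (char ?\<mu> (T * u)))\<^sup>2 * (cmod (char \<nu> (T * u)))\<^sup>2 \<le> (R + Q * l ^ b u) * (cmod (char \<nu> (T * u)))\<^sup>2"
      by (intro mult_right_mono \<mu>_le) auto
    also have "\<dots> \<le> R * (cmod (char \<nu> (T * u)))\<^sup>2 + Q * l ^ b u"
      using mult_left_mono[OF sq1[of "T * u"], of "Q * l ^ b u"] RQ l by (simp add: distrib_right)
    finally show "(cmod (char ?\<mu> (T * u)))\<^sup>2 * (cmod (char \<nu> (T * u)))\<^sup>2 \<le> R * (cmod (char \<nu> (T * u)))\<^sup>2 + Q * l ^ b u" .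
  qed
  also have "\<dots> = R * energy T \<nu> + Q * (\<integral>u. l ^ b u \<partial>triangle_law)"
    using int\<nu> intb by (simp add: energy_def)
  finally have split: "energy T (convolution ?\<mu> \<nu>) \<le> R * energy T \<nu> + Q * (\<integral>u. l ^ b u \<partial>triangle_law)" .
  have far_le: "(\<integral>u. l ^ b u \<partial>triangle_law)
      \<le> 4 * pi * (real (nat \<lceil>(1 + a) / a\<rceil>) / (1 + a)) * (a * (1 + l * of_int \<lceil>1 / a\<rceil>)) ^ N"
  proof -
    define f where "f = (\<lambda>y. ennreal (l ^ far_count a N y))"
    define k where "k = nat \<lceil>(1 + a) / a\<rceil>"
    define B where "B = 1 / (1 + a) * (a * (1 + l * of_int \<lceil>1 / a\<rceil>)) ^ N"
    have [measurable]: "f \<in> borel_measurable borel"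
      unfolding f_def by measurable
    have ceil: "0 \<le> real_of_int \<lceil>1 / a\<rceil>"
      by (rule order_trans[OF _ le_of_int_ceiling]) (use a in auto)
    have B0: "0 \<le> B"
      using a l ceil by (auto simp: B_def intro!: mult_nonneg_nonneg divide_nonneg_nonneg add_nonneg_nonneg)
    have k: "1 / a \<le> real k * (1 / (1 + a))"
    proof -
      have "(1 + a) / a \<le> real k"
        using a by (simp add: k_def)
      from mult_right_mono[OF this, of "1 / (1 + a)"] show ?thesis
        using a by simp
    qed
    have "ennreal (\<integral>u. l ^ b u \<partial>triangle_law) = (\<integral>\<^sup>+u. ennreal (l ^ b u) \<partial>triangle_law)"
      using intb l by (subst nn_integral_eq_integral) auto
    also have "\<dots> = (\<integral>\<^sup>+u. ennreal (2 * (1 - u) * indicator {0..1} u) * ennreal (l ^ b u) \<partial>lborel)"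
      unfolding triangle_law_def by (subst nn_integral_density) auto
    also have "\<dots> \<le> (\<integral>\<^sup>+u. 2 * (f (u / (1 / s)) * indicator {0..<0 + 1} u) \<partial>lborel)"
    proof (rule nn_integral_mono)
      fix u :: real
      show "ennreal (2 * (1 - u) * indicator {0..1} u) * ennreal (l ^ b u)
          \<le> 2 * (f (u / (1 / s)) * indicator {0..<0 + 1} u)"
      proof (cases "0 \<le> u \<and> u < 1")
        case True
        then have "ennreal (2 * (1 - u)) \<le> ennreal 2"
          by (intro ennreal_leI) auto
        \<comment> \<open>The triangular density is at most 2, and it vanishes at $u = 1$, so that the half-open interval suffices.\<close>
        then have "ennreal (2 * (1 - u)) * ennreal (l ^ b u) \<le> ennreal 2 * ennreal (l ^ b u)"
          by (rule mult_right_mono) simp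
        moreover have "u / (1 / s) = s * u"
          by simp
        ultimately show ?thesis
          using True by (simp only: f_def b_def) (simp add: indicator_def)
      qed (auto simp: indicator_def)
    qed
    also have "\<dots> = 2 * (ennreal (1 / s) * (\<integral>\<^sup>+y. f y * indicator {0 / (1 / s)..<0 / (1 / s) + 1 / (1 / s)} y \<partial>lborel))"
      using s(2) by (subst nn_integral_cmult, simp, subst nn_integral_interval_rescale) auto
    also have "\<dots> \<le> 2 * (ennreal (2 * pi) * (of_nat k * ennreal B))"
    proof (intro mult_left_mono mult_mono nn_integral_interval_cover)
      show "(\<integral>\<^sup>+y. f y * indicator {b..<b + 1 / (1 + a)} y \<partial>lborel) \<le> ennreal B" for b
        unfolding f_def B_def by (rule far_count_integral_le[OF a l])
      show "1 / (1 / s) \<le> real k * (1 / (1 + a))"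
        using k s(3) by simp
    qed (use s(1) in \<open>auto intro!: ennreal_leI\<close>)
    also have "\<dots> = ennreal (2 * (2 * pi * (real k * B)))"
      using B0 by (simp add: ennreal_mult ennreal_of_nat_eq_real_of_nat mult.assoc mult_numeral_left_semiring_numeral)
    finally have "(\<integral>u. l ^ b u \<partial>triangle_law) \<le> 2 * (2 * pi * (real k * B))"
      using B0 by (subst (asm) ennreal_le_iff) auto
    then show ?thesis
      by (simp add: k_def B_def)
  qed
  note split
  also have "R * energy T \<nu> + Q * (\<integral>u. l ^ b u \<partial>triangle_law) \<le> R * energy T \<nu>
      + Q * (4 * pi * (real (nat \<lceil>(1 + a) / a\<rceil>) / (1 + a)) * (a * (1 + l * of_int \<lceil>1 / a\<rceil>)) ^ N)"
    by (intro add_left_mono mult_left_mono far_le RQ)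
  finally show ?thesis
    unfolding R_def Q_def by (simp only: mult_ac)
qed

text \<open>The exponent $\varepsilon' > \varepsilon$ corresponds to the raised threshold $x'$, and $\beta > 1-\kappa+2\varepsilon$
is the decay rate of the contribution of the exceptional frequencies. Since $\dim_2\nu \le 1-\kappa$, both
rates exceed $\dim_2\nu + 2\varepsilon$.\<close>

lemma dim2_convolution_gt:
  fixes a \<kappa> \<epsilon> :: real and m :: nat and p :: "nat \<Rightarrow> real"
  assumes a: "0 < a" "a < 1" and m: "2 \<le> m"
    and p: "\<And>i. i \<in> {1..m} \<Longrightarrow> 0 < p i" "(\<Sum>i=1..m. p i) = 1"
    and adm: "admissible_eps a p \<kappa> \<epsilon>"
    and t: "t 1 = 0" "t 2 = 1" and \<nu>: "real_distribution \<nu>" and dim: "dim2 \<nu> \<le> ereal (1 - \<kappa>)"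
  shows "dim2 \<nu> + ereal (2 * \<epsilon>) < dim2 (convolution (self_similar_measure m a p t) \<nu>)"
proof -
  let ?\<mu> = "self_similar_measure m a p t"
  define \<rho> where "\<rho> = 1 - eta (a / (a + 1)) p"
  define x where "x = eps_tilde \<epsilon> a p"
  define K where "K = real_of_int \<lceil>1 / a\<rceil>"
  define L where "L = ln (1 / a)"
  interpret \<mu>: real_distribution ?\<mu>
    using self_similar_measure_real_distribution[of m p a t] p a by auto
  interpret \<nu>: real_distribution \<nu> by fact
  have \<rho>: "0 < \<rho>" "\<rho> < 1"
    using one_minus_eta_bounds[OF a m p] by (simp_all add: \<rho>_def)
  have L: "0 < L" "ln a = - L"
    using a by (simp_all add: L_def ln_div)
  have x: "0 < x" "x < 1" and \<epsilon>: "0 < \<epsilon>" and \<delta>: "\<kappa> - 2 * \<epsilon> = delta \<epsilon> a p"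
    using adm by (auto simp: admissible_eps_def x_def)
  have K: "1 \<le> K"
    using a by (simp add: K_def)
  have ceil: "real_of_int \<lceil>1 + 1 / a\<rceil> = K + 1"
    using ceiling_add_of_int[of "1 / a" 1] by (simp add: K_def add.commute)
  obtain l x' where l: "0 < l" "l \<le> 1" and x': "x < x'"
    and gap: "ln (1 + l * K) - x' * ln l < x * ln (K + 1) + entropy_fun x"
    using exponent_gap[OF x K] by blast
  define \<theta> where "\<theta> = ln (1 + l * K) - x' * ln l"
  define \<beta> where "\<beta> = 1 - \<theta> / L"
  define \<epsilon>' where "\<epsilon>' = \<epsilon> * x' / x"
  have \<epsilon>': "\<epsilon> < \<epsilon>'"
    using x x' \<epsilon> by (simp add: \<epsilon>'_def field_simps)
  have "\<theta> / L < (x * ln (K + 1) + entropy_fun x) / L"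
    using gap L by (simp add: \<theta>_def divide_strict_right_mono)
  also have "\<dots> = \<kappa> - 2 * \<epsilon>"
    unfolding \<delta> delta_def ceil x_def[symmetric] L_def by (simp only: mult.commute)
  finally have \<beta>: "1 - \<kappa> + 2 * \<epsilon> < \<beta>"
    by (simp add: \<beta>_def)
  obtain s where s: "dim2 \<nu> = ereal s" "0 \<le> s" "s \<le> 1 - \<kappa>"
    using \<nu>.dim2_nonneg dim by (cases "dim2 \<nu>") auto
  have x_\<rho>: "x' * ln \<rho> = \<epsilon>' * ln a"
  proof -
    have "x = ln a / ln \<rho> * \<epsilon>"
      by (simp add: x_def eps_tilde_def \<rho>_def)
    then have "x * ln \<rho> = \<epsilon> * ln a"
      using \<rho> by simp
    then show ?thesis
      using x by (simp add: \<epsilon>'_def field_simps)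
  qed
  obtain C0 where C0: "0 < C0" "\<And>\<nu> n. real_distribution \<nu> \<Longrightarrow> energy (2 ^ n) \<nu> \<le> C0 * dyadic_sum n \<nu>"
    using energy_le_dyadic_sum by blast
  define C where "C = 4 * pi * (real (nat \<lceil>(1 + a) / a\<rceil>) / (1 + a))"
  have C: "0 \<le> C"
    unfolding C_def using a by (intro mult_nonneg_nonneg divide_nonneg_nonneg of_nat_0_le_iff) auto
  define A where "A = 2 * (1 / a) powr (2 * \<epsilon>') * C0"
  define B where "B = 2 * C * (1 / a) powr \<beta>"
  have scale: "(a ^ N) powr e \<le> (1 / a) powr e * 2 powr (- e * real n)"
    if "a ^ N * 2 ^ n \<le> 1 / a" "0 \<le> e" for e N n
  proof -
    have "a ^ N \<le> 1 / a * 2 powr (- real n)"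
    proof -
      have "a ^ N \<le> 1 / a / 2 ^ n"
        using that(1) by (subst pos_le_divide_eq) auto
      then show ?thesis
        by (simp add: powr_minus powr_realpow divide_inverse)
    qed
    then have "(a ^ N) powr e \<le> (1 / a * 2 powr (- real n)) powr e"
      using that a by (intro powr_mono2) auto
    also have "\<dots> = (1 / a) powr e * 2 powr (- e * real n)"
      using a by (subst powr_mult) (auto simp: powr_powr mult.commute)
    finally show ?thesis .
  qed
  have \<sigma>: "real_distribution (convolution ?\<mu> \<nu>)"
    by (rule real_distribution_convolution) (fact \<mu>.real_distribution_axioms \<nu>)+
  interpret \<sigma>: real_distribution "convolution ?\<mu> \<nu>" by fact
  have main: "dyadic_sum n (convolution ?\<mu> \<nu>)
      \<le> A * 2 powr (- (2 * \<epsilon>') * real n) * dyadic_sum n \<nu> + B * 2 powr (- \<beta> * real n)" for n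
  proof -
    obtain N where N: "1 \<le> a ^ N * 2 ^ n" "a ^ N * 2 ^ n \<le> 1 / a"
      using ex_scale[OF a, of "2 ^ n"] by auto
    have "\<rho> powr (2 * (x' * real N)) = exp (2 * real N * (x' * ln \<rho>))"
      using \<rho> by (simp add: powr_def mult_ac)
    also have "\<dots> = (a ^ N) powr (2 * \<epsilon>')"
      using a by (simp add: x_\<rho> powr_def ln_realpow mult_ac)
    also have "\<dots> \<le> (1 / a) powr (2 * \<epsilon>') * 2 powr (- (2 * \<epsilon>') * real n)"
      using \<epsilon> \<epsilon>' by (intro scale N) auto
    finally have 1: "\<rho> powr (2 * (x' * real N)) \<le> (1 / a) powr (2 * \<epsilon>') * 2 powr (- (2 * \<epsilon>') * real n)" .
    have pos: "0 < 1 + l * K"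
      using l K by (simp add: add_pos_nonneg)
    have "l powr (- (x' * real N)) * (a * (1 + l * K)) ^ N
        = exp (real N * (ln a + \<theta>))"
    proof -
      have "ln (a * (1 + l * K)) = ln a + ln (1 + l * K)"
        using a pos by (subst ln_mult) auto
      moreover have "(a * (1 + l * K)) ^ N = exp (real N * ln (a * (1 + l * K)))"
        using a pos by (simp add: exp_of_nat_mult)
      ultimately have "(a * (1 + l * K)) ^ N = exp (real N * (ln a + ln (1 + l * K)))"
        by simp
      moreover have "l powr (- (x' * real N)) = exp (- (x' * real N) * ln l)"
        using l by (simp add: powr_def)
      moreover have "- (x' * real N) * ln l + real N * (ln a + ln (1 + l * K)) = real N * (ln a + \<theta>)"
        by (simp add: \<theta>_def algebra_simps)
      ultimately show ?thesis
        by (simp only: exp_add[symmetric])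
    qed
    also have "\<dots> = (a ^ N) powr \<beta>"
      using a L by (simp add: powr_def ln_realpow \<beta>_def field_simps)
    also have "\<dots> \<le> (1 / a) powr \<beta> * 2 powr (- \<beta> * real n)"
      using \<beta> s \<epsilon> by (intro scale N) auto
    finally have 2: "l powr (- (x' * real N)) * (a * (1 + l * K)) ^ N \<le> (1 / a) powr \<beta> * 2 powr (- \<beta> * real n)" .
    have e0: "0 \<le> energy (2 ^ n) \<nu>"
      by (simp add: energy_def)
    have "dyadic_sum n (convolution ?\<mu> \<nu>) \<le> 2 * energy (2 ^ n) (convolution ?\<mu> \<nu>)"
      by (rule \<sigma>.dyadic_sum_le_energy)
    also have "\<dots> \<le> 2 * (\<rho> powr (2 * (x' * real N)) * energy (2 ^ n) \<nu>
        + C * (l powr (- (x' * real N)) * (a * (1 + l * K)) ^ N))"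
      unfolding \<rho>_def C_def K_def
      by (intro mult_left_mono energy_convolution_le a m p l t \<nu> N) auto
    also have "\<dots> \<le> 2 * ((1 / a) powr (2 * \<epsilon>') * 2 powr (- (2 * \<epsilon>') * real n) * (C0 * dyadic_sum n \<nu>)
        + C * ((1 / a) powr \<beta> * 2 powr (- \<beta> * real n)))"
      by (intro mult_left_mono add_mono mult_mono 1 2 C0(2) \<nu> C e0) auto
    also have "\<dots> = A * 2 powr (- (2 * \<epsilon>') * real n) * dyadic_sum n \<nu> + B * 2 powr (- \<beta> * real n)"
      by (simp add: A_def B_def algebra_simps)
    finally show ?thesis .
  qed
  have "ereal (s + 2 * \<epsilon>) < dim2 (convolution ?\<mu> \<nu>)"
  proof (rule dim2_less_of_dyadic_sum_le[OF \<nu> \<sigma> main])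
    show "0 \<le> A" "0 \<le> B"
      using C0 C by (simp_all add: A_def B_def)
    show "dim2 \<nu> = ereal s" "s + 2 * \<epsilon> < s + 2 * \<epsilon>'" "s + 2 * \<epsilon> < \<beta>"
      using s \<epsilon>' \<beta> by auto
  qed
  then show ?thesis
    by (simp add: s)
qed

theorem theorem4p1:
  fixes a \<kappa> :: real and m :: nat and p :: "nat \<Rightarrow> real"
  assumes "0 < a" and "a < 1"
    and "2 \<le> m"
    and "\<forall>i\<in>{1..m}. 0 < p i" and "(\<Sum>i=1..m. p i) = 1"
    and "0 < \<kappa>"
  shows "(\<exists>\<sigma>>0. \<forall>t :: nat \<Rightarrow> real. t 1 = 0 \<and> t 2 = 1 \<longrightarrow>
            (\<forall>\<nu>. real_distribution \<nu> \<and> dim2 \<nu> \<le> ereal (1 - \<kappa>) \<longrightarrow>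
               dim2 (convolution (self_similar_measure m a p t) \<nu>) > dim2 \<nu> + ereal \<sigma>))
       \<and> (\<kappa> \<le> 1 \<longrightarrow> (\<exists>\<epsilon>. admissible_eps a p \<kappa> \<epsilon>))
       \<and> (\<forall>\<epsilon>. admissible_eps a p \<kappa> \<epsilon> \<longrightarrow>
            (\<forall>t :: nat \<Rightarrow> real. t 1 = 0 \<and> t 2 = 1 \<longrightarrow>
              (\<forall>\<nu>. real_distribution \<nu> \<and> dim2 \<nu> \<le> ereal (1 - \<kappa>) \<longrightarrow>
                 dim2 (convolution (self_similar_measure m a p t) \<nu>) > dim2 \<nu> + ereal (2 * \<epsilon>))))"
proof (intro conjI)
  have \<rho>: "0 < 1 - eta (a / (a + 1)) p" "1 - eta (a / (a + 1)) p < 1"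
    using assms(4) one_minus_eta_bounds[OF assms(1-3) _ assms(5)] by blast+
  have flat: "dim2 \<nu> + ereal (2 * \<epsilon>) < dim2 (convolution (self_similar_measure m a p t) \<nu>)"
    if "admissible_eps a p \<kappa> \<epsilon>" "t 1 = 0" "t 2 = 1" "real_distribution \<nu>" "dim2 \<nu> \<le> ereal (1 - \<kappa>)"
    for \<epsilon> t \<nu>
    using assms that by (intro dim2_convolution_gt) auto
  show ex: "\<kappa> \<le> 1 \<longrightarrow> (\<exists>\<epsilon>. admissible_eps a p \<kappa> \<epsilon>)"
    using ex_admissible_eps[OF assms(1,2) \<rho> assms(6)] by blast
  show "\<forall>\<epsilon>. admissible_eps a p \<kappa> \<epsilon> \<longrightarrow>
            (\<forall>t :: nat \<Rightarrow> real. t 1 = 0 \<and> t 2 = 1 \<longrightarrow>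
              (\<forall>\<nu>. real_distribution \<nu> \<and> dim2 \<nu> \<le> ereal (1 - \<kappa>) \<longrightarrow>
                 dim2 (convolution (self_similar_measure m a p t) \<nu>) > dim2 \<nu> + ereal (2 * \<epsilon>)))"
    using flat by blast
  show "\<exists>\<sigma>>0. \<forall>t :: nat \<Rightarrow> real. t 1 = 0 \<and> t 2 = 1 \<longrightarrow>
            (\<forall>\<nu>. real_distribution \<nu> \<and> dim2 \<nu> \<le> ereal (1 - \<kappa>) \<longrightarrow>
               dim2 (convolution (self_similar_measure m a p t) \<nu>) > dim2 \<nu> + ereal \<sigma>)"
  proof (cases "\<kappa> \<le> 1")
    case True
    then obtain \<epsilon> where \<epsilon>: "admissible_eps a p \<kappa> \<epsilon>"
      using ex by blast
    then have "0 < 2 * \<epsilon>"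
      by (simp add: admissible_eps_def)
    with flat[OF \<epsilon>] show ?thesis
      by blast
  next
    case False
    \<comment> \<open>Correlation dimensions are nonnegative, so for $\kappa > 1$ no measure $\nu$ qualifies.\<close>
    have "\<not> dim2 \<nu> \<le> ereal (1 - \<kappa>)" if "real_distribution \<nu>" for \<nu>
    proof -
      have "ereal (1 - \<kappa>) < 0"
        using False by simp
      then show ?thesis
        using real_distribution.dim2_nonneg[OF that] by (meson leD order_trans)
    qed
    then show ?thesis
      by (intro exI[of _ 1]) auto
  qed
qed

end
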